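(* Let $\mathbb{L}\subset\mathbb{Z}^N$ be a rank $2$ subgroup which is not contained in any of the standard coordinate hyperplanes of $\mathbb{Z}^N$ and is perpendicular to $(1,\ldots,1)$. Let $\mathcal{S}$ be a perfect surface for $\mathbb{L}$ (as defined in the context), let $E$ be its set of tiles, and let $\Gamma^{\bullet\circ}$ be the associated bipartite graph, whose set of edges is identified with $E$. Let $C$ be a $2$-dimensional cone in the secondary fan of $\mathbb{L}\subset\mathbb{Z}^N$ and let $L_C$ be the corresponding collection of $2$-element subsets of $\{1,\ldots,N\}$. Then the set $$P_C=\{e\in E\;|\;\{\mathbf{r}(e),\mathbf{r}'(e)\}\in L_C\}$$ is a perfect matching on $\Gamma^{\bullet\circ}$.
   Context: Notation: $\mathbf{e}_1,\ldots,\mathbf{e}_N$ is the standard basis of $\mathbb{Z}^N$; "perpendicular to $(1,\ldots,1)$" means all elements of $\mathbb{L}$ have coordinate sum $0$. Let $B$ be a $2\times N$-matrix whose rows form a $\mathbb{Z}$-basis of $\mathbb{L}$, with columns $\mathbf{b}_1,\ldots,\mathbf{b}_N$; these are viewed as vectors in $\mathbb{L}_{\mathbb{R}}^\vee=\mathrm{Hom}(\mathbb{L},\mathbb{R})\simeq\mathbb{R}^2$ ($\mathbf{b}_i$ is the image of $\mathbf{e}_i$ under the map $\mathbb{R}^N\to\mathbb{L}_{\mathbb{R}}^\vee$ dual to the inclusion). Secondary fan: it consists of $\{0\}$, the half-lines $\mathbb{R}_{\geq 0}\mathbf{b}_i$, and the $2$-dimensional cones which are the closures of the connected components of $\mathbb{L}_{\mathbb{R}}^\vee\setminus\bigcup_{i}\mathbb{R}_{\geq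 0}\mathbf{b}_i$. For a $2$-dimensional cone $C$, $L_C=\{\{i,j\}\subset\{1,\ldots,N\}\;|\;C\subset\mathbb{R}_{\geq 0}\mathbf{b}_i+\mathbb{R}_{\geq 0}\mathbf{b}_j\}$. Surfaces: let $\mathbb{L}_{\mathbb{R}}\subset\mathbb{R}^N$ be the real plane spanned by $\mathbb{L}$. For $\lambda\in\mathbb{R}^N$ the grid lines in $\lambda+\mathbb{L}_{\mathbb{R}}$ are $\mathcal{L}^\lambda_{i,k}=\{z\in\lambda+\mathbb{L}_{\mathbb{R}}\,|\,z_i=k\}$ ($1\leq i\leq N$, $k\in\mathbb{Z}$); $\lambda$ is non-resonant if no three grid lines pass through one point. Let $F(z_1,\ldots,z_N)=(\lfloor z_1\rfloor,\ldots,\lfloor z_N\rfloor)$. For non-resonant $\lambda$ put $\mathcal{S}^0=F(\lambda+\mathbb{L}_{\mathbb{R}})$ and let $\mathcal{S}$ be the union of all unit squares in $\mathbb{R}^N$ with vertices in $\mathcal{S}^0$, i.e. the squares $\mathbf{p}+\mathrm{conv}(0,\mathbf{e}_i,\mathbf{e}_j,\mathbf{e}_i+\mathbf{e}_j)$, $i\neq j$, all of whose vertices lie in $\mathcal{S}^0$ (such a square has type $(i,j)$). The group $\mathbb{L}$ acts by translations on $\mathcal{S}^0$ and $\mathcal{S}$. An elementary transformation of $\mathcal{S}$: given $\mathbf{p}_0\in\mathcal{S}^0$ with exactly three points $\mathbf{p}_1,\mathbf{p}_2,\mathbf{p}_3\in\mathcal{S}^0$ at distance $1$ and such that $\mathbf{p}_1+\mathbf{p}_2-\mathbf{p}_0$,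 $\mathbf{p}_1+\mathbf{p}_3-\mathbf{p}_0$, $\mathbf{p}_2+\mathbf{p}_3-\mathbf{p}_0$ also lie in $\mathcal{S}^0$, replace, for all $\ell\in\mathbb{L}$ simultaneously, $\mathbf{p}_0+\ell$ by $\mathbf{p}_1+\mathbf{p}_2+\mathbf{p}_3-2\mathbf{p}_0+\ell$; this gives a new set $\mathcal{S}'^0$, and $\mathcal{S}'$ is the union of all unit squares with vertices in $\mathcal{S}'^0$ (three squares around $\mathbf{p}_0+\ell$ are replaced by three squares around the new point). A surface $\mathcal{S}$ obtained from some non-resonant $\lambda$ by finitely many (possibly zero) elementary transformations is perfect if $\mathbf{s}(z)=z_1+\ldots+z_N$ takes only three values on $\mathcal{S}^0$; these are consecutive integers $a-1,a,a+1$. Vertices with $\mathbf{s}=a+1$ are black, those with $\mathbf{s}=a-1$ are white, those with $\mathbf{s}=a$ are grey. Each unit square of a perfect surface has one black, one white and two grey vertices. Tiles and graph: for a perfect $\mathcal{S}$, $E$ is the set of $\mathbb{L}$-orbits of unit squares in $\mathcal{S}$ (the tiles of the torus $\mathcal{S}/\mathbb{L}$). For $e\in E$, $\mathbf{b}(e)$ and $\mathbf{w}(e)$ denote the $\mathbb{L}$-orbits of its black and white vertex, and $\{\mathbf{r}(e),\mathbf{r}'(e)\}=\{i,j\}$ if the square has type $(i,j)$. The bipartite graph $\Gamma^{\bullet\circ}$ has as nodes the $\mathbb{L}$-orbits of black and of white vertices and has one edge for each $e\in E$ (the black-white diagonal of the square), connecting $\mathbf{b}(e)$ and $\mathbf{w}(e)$.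 A perfect matching on $\Gamma^{\bullet\circ}$ is a subset of its edges such that every node is incident to exactly one edge in the subset. *)

theory Defs
  imports "HOL-Analysis.Analysis"
begin

definition rvec :: "int ^ 'n \<Rightarrow> real ^ 'n" where
  "rvec p = (\<chi> i. real_of_int (p $ i))"

section \<open>The lattice and its secondary fan\<close>

text \<open>The rows of the \<open>2 \<times> N\<close> matrix \<open>B\<close> are a \<open>\<int>\<close>-basis of \<open>L\<close>: they generate \<open>L\<close> and are
  linearly independent over \<open>\<int>\<close>. In particular \<open>L\<close> is then a subgroup of rank 2.\<close>

definition Z_basis :: "(int ^ 'n::finite) set \<Rightarrow> int ^ 'n ^ 2 \<Rightarrow> bool" where
  "Z_basis L B \<longleftrightarrow> L = range (\<lambda>c :: int ^ 2. c v* B) \<and> inj (\<lambda>c :: int ^ 2. c v* B)"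

text \<open>The dual plane \<open>Hom(L, \<real>)\<close> is identified with \<open>\<real>\<^sup>2\<close> by evaluating at the two rows of \<open>B\<close>;
  the \<open>i\<close>-th coordinate function of \<open>L\<close> then becomes the \<open>i\<close>-th column of \<open>B\<close>.\<close>

definition bvec :: "int ^ 'n ^ 2 \<Rightarrow> 'n::finite \<Rightarrow> real ^ 2" where
  "bvec B i = rvec (column i B)"

definition half_line :: "real ^ 2 \<Rightarrow> (real ^ 2) set" where
  "half_line b = {t *\<^sub>R b | t. t \<ge> 0}"

definition two_dim_cones :: "int ^ 'n::finite ^ 2 \<Rightarrow> (real ^ 2) set set" where
  "two_dim_cones B = closure ` components (UNIV - (\<Union>i. half_line (bvec B i)))"

definition cone_pairs :: "int ^ 'n::finite ^ 2 \<Rightarrow> (real ^ 2) set \<Rightarrow> 'n set set" where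
  "cone_pairs B C =
     {{i, j} | i j. i \<noteq> j \<and>
        C \<subseteq> {s *\<^sub>R bvec B i + t *\<^sub>R bvec B j | s t. s \<ge> 0 \<and> t \<ge> 0}}"

section \<open>Surfaces\<close>

text \<open>A surface is represented by its set of vertices (in \<open>\<int>\<^sup>N\<close>), which determines its
  unit squares and hence the surface, their union.\<close>

definition real_plane :: "(int ^ 'n::finite) set \<Rightarrow> real ^ 'n \<Rightarrow> (real ^ 'n) set" where
  "real_plane L lam = (\<lambda>x. lam + x) ` span (rvec ` L)"

definition grid_line :: "(int ^ 'n::finite) set \<Rightarrow> real ^ 'n \<Rightarrow> 'n \<Rightarrow> int \<Rightarrow> (real ^ 'n) set" where
  "grid_line L lam i k = {z \<in> real_plane L lam. z $ i = of_int k}"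

text \<open>Grid lines are counted by their labels \<open>(i, k)\<close>, so that two coinciding grid lines with
  different labels count as two.
  (For each \<open>i\<close> at most one \<open>k\<close> occurs, so the set below is always finite.)\<close>

definition non_resonant :: "(int ^ 'n::finite) set \<Rightarrow> real ^ 'n \<Rightarrow> bool" where
  "non_resonant L lam \<longleftrightarrow> (\<forall>z. card {(i, k). z \<in> grid_line L lam i k} \<le> 2)"

definition floor_vec :: "real ^ 'n \<Rightarrow> int ^ 'n" where
  "floor_vec z = (\<chi> i. \<lfloor>z $ i\<rfloor>)"

definition orbit :: "(int ^ 'n::finite) set \<Rightarrow> int ^ 'n \<Rightarrow> (int ^ 'n) set" where
  "orbit L p = {p + l | l. l \<in> L}"

definition elementary_transformation ::
    "(int ^ 'n::finite) set \<Rightarrow> (int ^ 'n) set \<Rightarrow> (int ^ 'n) set \<Rightarrow> bool" where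
  "elementary_transformation L V V' \<longleftrightarrow>
     (\<exists>p0 p1 p2 p3.
        p0 \<in> V \<and>
        {q \<in> V. dist (rvec q) (rvec p0) = 1} = {p1, p2, p3} \<and>
        p1 \<noteq> p2 \<and> p1 \<noteq> p3 \<and> p2 \<noteq> p3 \<and>
        p1 + p2 - p0 \<in> V \<and> p1 + p3 - p0 \<in> V \<and> p2 + p3 - p0 \<in> V \<and>
        V' = (V - orbit L p0) \<union> orbit L (p1 + p2 + p3 - 2 *s p0))"

inductive surface_vertices :: "(int ^ 'n::finite) set \<Rightarrow> (int ^ 'n) set \<Rightarrow> bool"
  for L :: "(int ^ 'n::finite) set" where
  initial: "non_resonant L lam \<Longrightarrow> surface_vertices L (floor_vec ` real_plane L lam)"
| transform: "surface_vertices L V \<Longrightarrow> elementary_transformation L V V' \<Longrightarrow> surface_vertices L V'"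

definition coord_sum :: "int ^ 'n::finite \<Rightarrow> int" where
  "coord_sum p = (\<Sum>i\<in>UNIV. p $ i)"

text \<open>The integer \<open>a\<close> is the level of the grey vertices; it is determined by \<open>V\<close>.\<close>

definition perfect_surface :: "(int ^ 'n::finite) set \<Rightarrow> (int ^ 'n) set \<Rightarrow> int \<Rightarrow> bool" where
  "perfect_surface L V a \<longleftrightarrow> surface_vertices L V \<and> coord_sum ` V = {a - 1, a, a + 1}"

section \<open>Tiles and the bipartite graph\<close>

definition corners :: "int ^ 'n::finite \<Rightarrow> 'n \<Rightarrow> 'n \<Rightarrow> (int ^ 'n) set" where
  "corners p i j = {p, p + axis i 1, p + axis j 1, p + axis i 1 + axis j 1}"

definition unit_square :: "int ^ 'n::finite \<Rightarrow> 'n \<Rightarrow> 'n \<Rightarrow> (real ^ 'n) set" where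
  "unit_square p i j = convex hull (rvec ` corners p i j)"

definition squares :: "(int ^ 'n::finite) set \<Rightarrow> (real ^ 'n) set set" where
  "squares V = {unit_square p i j | p i j. i \<noteq> j \<and> corners p i j \<subseteq> V}"

definition square_orbit ::
    "(int ^ 'n::finite) set \<Rightarrow> (real ^ 'n) set \<Rightarrow> (real ^ 'n) set set" where
  "square_orbit L Q = {(\<lambda>x. rvec l + x) ` Q | l. l \<in> L}"

definition tiles :: "(int ^ 'n::finite) set \<Rightarrow> (int ^ 'n) set \<Rightarrow> (real ^ 'n) set set set" where
  "tiles L V = square_orbit L ` squares V"

definition tile_type :: "(real ^ 'n::finite) set set \<Rightarrow> 'n set" where
  "tile_type e = (THE I. \<exists>p i j. i \<noteq> j \<and> unit_square p i j \<in> e \<and> I = {i, j})"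

text \<open>The \<open>L\<close>-orbit of the vertex at level \<open>m\<close> of a tile; it is well defined on the tiles of a
  perfect surface for \<open>m = a + 1\<close> (black) and \<open>m = a - 1\<close> (white).\<close>

definition vertex_class ::
    "(int ^ 'n::finite) set \<Rightarrow> int \<Rightarrow> (real ^ 'n) set set \<Rightarrow> (int ^ 'n) set" where
  "vertex_class L m e =
     (THE v. \<exists>Q p. Q \<in> e \<and> rvec p extreme_point_of Q \<and> coord_sum p = m \<and> v = orbit L p)"

text \<open>Multigraphs: \<open>ends e\<close> is the set of end points of the edge \<open>e\<close>.\<close>

record ('v, 'e) multigraph =
  nodes :: "'v set"
  edges :: "'e set"
  ends :: "'e \<Rightarrow> 'v set"

definition perfect_matching :: "('v, 'e) multigraph \<Rightarrow> 'e set \<Rightarrow> bool" where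
  "perfect_matching G M \<longleftrightarrow>
     M \<subseteq> edges G \<and> (\<forall>v \<in> nodes G. \<exists>!e. e \<in> M \<and> v \<in> ends G e)"

definition bipartite_graph ::
    "(int ^ 'n::finite) set \<Rightarrow> (int ^ 'n) set \<Rightarrow> int
       \<Rightarrow> ((int ^ 'n) set, (real ^ 'n) set set) multigraph" where
  "bipartite_graph L V a =
     \<lparr>nodes = orbit L ` {p \<in> V. coord_sum p = a + 1} \<union> orbit L ` {p \<in> V. coord_sum p = a - 1},
      edges = tiles L V,
      ends = (\<lambda>e. {vertex_class L (a + 1) e, vertex_class L (a - 1) e})\<rparr>"

end

theory Submission
  imports Defs
begin

text \<open>
  Project the surface to the dual plane of the lattice by \<open>p \<mapsto> \<Sum>\<^sub>i p\<^sub>i b\<^sub>i\<close>. The unit squares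
  become parallelograms with sides \<open>b\<^sub>i\<close>, \<open>b\<^sub>j\<close> that tile the plane; for a surface that comes from a
  line arrangement this is the tiling dual to the arrangement, and an elementary transformation
  turns over a hexagon that consists of three tiles. At a vertex \<open>p\<close> of a tiling every generic
  direction belongs to the angle of exactly one tile. At a white vertex all edges lead upwards, so
  these angles are the cones spanned by \<open>b\<^sub>i\<close>, \<open>b\<^sub>j\<close>; at a black vertex they are the opposite cones. For
  a direction \<open>u\<close> (respectively \<open>- u\<close>) taken from the interior of \<open>C\<close>, this tile is the only
  one at \<open>p\<close> whose type belongs to \<open>L\<^sub>C\<close>. This is the perfect matching.

  Neither the projection nor the tiling is constructed. The argument uses the combinatorial
  invariant \<open>stepped\<close> of the vertex set, which has three essential parts.
  \<^item> Any two vertices are \<open>aligned\<close>: the coordinates in which they differ change in the way in which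
    they would change along some straight line.
  \<^item> From each vertex one can \<open>approach\<close> any other vertex by a step to a neighbour.
  \<^item> The angles (\<open>sector\<close>) at each vertex cover the plane.

  The third part gives the tile that matches a given vertex, and the first part excludes a
  second one: if two angles at a vertex overlapped, then some edge would run inside the angle of a
  square, and its end point would not be aligned with the opposite corner of this square
  (\<open>neighbour_not_in_square_cone\<close>, \<open>square_cone_unique\<close>).

  The invariant holds for line arrangements (\<open>stepped_initial\<close>), because at most two grid lines meet
  in a point: the path that approaches another vertex is found on a straight segment, and the sector
  that contains \<open>u\<close> at the corner of the cell at which \<open>u\<close> is maximal. It is preserved by
  elementary transformations (\<open>stepped_elementary_transformation\<close>), where the first two parts support
  each other. A transformation inverts a triangular cell \<open>p0\<close>. Alignment could only fail for the new
  vertex \<open>q\<close> and a vertex that agrees with \<open>p0\<close> relative to the three sides of the triangle; but from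
  \<open>p0\<close> one can approach other vertices only by crossing one of these sides. Conversely, alignment with
  \<open>p0\<close> shows that no vertex lies beyond all three sides, and therefore every vertex can be approached
  from \<open>q\<close>.
\<close>

section \<open>Planar vectors\<close>

definition det2 :: "real ^ 2 \<Rightarrow> real ^ 2 \<Rightarrow> real" where
  "det2 v w = v $ 1 * w $ 2 - v $ 2 * w $ 1"

definition cone2 :: "real ^ 2 \<Rightarrow> real ^ 2 \<Rightarrow> (real ^ 2) set" where
  "cone2 v w = {s *\<^sub>R v + t *\<^sub>R w | s t. s \<ge> 0 \<and> t \<ge> 0}"

definition rot :: "real ^ 2 \<Rightarrow> real ^ 2" where
  "rot v = vector [- v $ 2, v $ 1]"

lemma inner2: "x \<bullet> y = x $ 1 * y $ 1 + x $ 2 * y $ 2" for x y :: "real ^ 2"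
  by (simp add: inner_vec_def sum_2)

lemma vec2_eq_iff: "x = y \<longleftrightarrow> x $ 1 = y $ 1 \<and> x $ 2 = y $ 2" for x y :: "real ^ 2"
  by (simp add: vec_eq_iff forall_2)

lemma rot_inner: "rot v \<bullet> w = det2 v w"
  by (simp add: inner2 rot_def det2_def)

lemma rot_nonzero: "v \<noteq> 0 \<Longrightarrow> rot v \<noteq> 0"
  by (auto simp: vec2_eq_iff rot_def)

lemma det2_scale: "det2 (s *\<^sub>R v) (t *\<^sub>R w) = s * t * det2 v w"
  by (simp add: det2_def algebra_simps)

lemma det2_commute: "det2 v w = - det2 w v"
  by (simp add: det2_def)

lemma cramer: "det2 v w *\<^sub>R u = det2 u w *\<^sub>R v + det2 v u *\<^sub>R w"
  by (simp add: vec2_eq_iff det2_def algebra_simps)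

lemma cramer_coordinates:
  assumes "det2 v w \<noteq> 0"
  shows "u = (det2 u w / det2 v w) *\<^sub>R v + (det2 v u / det2 v w) *\<^sub>R w"
proof -
  have "u = (1 / det2 v w) *\<^sub>R (det2 v w *\<^sub>R u)" using assms by simp
  also have "\<dots> = (det2 u w / det2 v w) *\<^sub>R v + (det2 v u / det2 v w) *\<^sub>R w"
    unfolding cramer[of v w u] by (simp add: scaleR_add_right)
  finally show ?thesis .
qed

lemma cone2_commute: "cone2 v w = cone2 w v"
  by (auto simp: cone2_def) (metis add.commute)+

lemma cone2_independent:
  assumes "det2 v w \<noteq> 0"
  shows "cone2 v w = {u. det2 u w / det2 v w \<ge> 0 \<and> det2 v u / det2 v w \<ge> 0}"
proof (intro set_eqI iffI)
  fix u assume "u \<in> cone2 v w"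
  then obtain s t where "s \<ge> 0" "t \<ge> 0" and u: "u = s *\<^sub>R v + t *\<^sub>R w"
    by (auto simp: cone2_def)
  have "det2 u w = s * det2 v w" "det2 v u = t * det2 v w"
    by (simp_all add: u det2_def algebra_simps)
  then show "u \<in> {u. det2 u w / det2 v w \<ge> 0 \<and> det2 v u / det2 v w \<ge> 0}"
    using assms \<open>s \<ge> 0\<close> \<open>t \<ge> 0\<close> by simp
next
  fix u assume "u \<in> {u. det2 u w / det2 v w \<ge> 0 \<and> det2 v u / det2 v w \<ge> 0}"
  then show "u \<in> cone2 v w"
    using cramer_coordinates[OF assms, of u] unfolding cone2_def by blast
qed

lemma parallel_if_det2_zero:
  assumes "v \<noteq> 0" "det2 v w = 0"
  obtains c where "w = c *\<^sub>R v"
proof (cases "v $ 1 = 0")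
  case True
  with assms have "v $ 2 \<noteq> 0" by (auto simp: vec2_eq_iff)
  then have "w = (w $ 2 / v $ 2) *\<^sub>R v"
    using True assms by (auto simp: vec2_eq_iff det2_def)
  then show ?thesis by (rule that)
next
  case False
  then have "w = (w $ 1 / v $ 1) *\<^sub>R v"
    using assms by (auto simp: vec2_eq_iff det2_def field_simps)
  then show ?thesis by (rule that)
qed

lemma prescribed_inner_products:
  assumes "det2 v w \<noteq> 0"
  obtains y where "y \<bullet> v = a" "y \<bullet> w = c"
proof
  let ?y = "(1 / det2 v w) *\<^sub>R vector [a * w $ 2 - c * v $ 2, c * v $ 1 - a * w $ 1] :: real ^ 2"
  have "(a * w $ 2 - c * v $ 2) * v $ 1 + (c * v $ 1 - a * w $ 1) * v $ 2 = a * det2 v w"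
    "(a * w $ 2 - c * v $ 2) * w $ 1 + (c * v $ 1 - a * w $ 1) * w $ 2 = c * det2 v w"
    by (simp_all add: det2_def algebra_simps)
  then show "?y \<bullet> v = a" "?y \<bullet> w = c"
    using assms by (simp_all add: inner2 add_divide_distrib[symmetric])
qed

text \<open>Three vectors that no open half-plane avoids are in the position of the outer normals of a
  triangle. Testing the hypothesis on the normals of the three lines that they span determines
  the signs of all pairwise determinants, and Cramer's rule does the rest.\<close>

lemma positively_spanning_triple:
  assumes nz: "w1 \<noteq> 0" "w2 \<noteq> 0" "w3 \<noteq> 0"
    and span: "\<And>y. y \<noteq> 0 \<Longrightarrow> y \<bullet> w1 > 0 \<or> y \<bullet> w2 > 0 \<or> y \<bullet> w3 > 0"
  shows "det2 w2 w3 \<noteq> 0 \<and> (\<exists>c > 0. \<exists>d > 0. - w1 = c *\<^sub>R w2 + d *\<^sub>R w3)"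
proof -
  have r: "det2 v w1 > 0 \<or> det2 v w2 > 0 \<or> det2 v w3 > 0"
    "det2 v w1 < 0 \<or> det2 v w2 < 0 \<or> det2 v w3 < 0" if "v \<noteq> 0" for v
    using span[of "rot v"] span[of "- rot v"] rot_nonzero[OF that] by (auto simp: rot_inner)
  have self: "det2 v v = 0" for v by (simp add: det2_def)
  note all = r[OF nz(1)] r[OF nz(2)] r[OF nz(3)]
  have s: "(det2 w2 w3 > 0 \<and> det2 w1 w3 < 0 \<and> det2 w2 w1 < 0) \<or>
      (det2 w2 w3 < 0 \<and> det2 w1 w3 > 0 \<and> det2 w2 w1 > 0)"
    using all self det2_commute[of w1 w2] det2_commute[of w1 w3] det2_commute[of w2 w3]
    by (smt (verit))
  then have d: "det2 w2 w3 \<noteq> 0" by auto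
  have "- w1 = (- det2 w1 w3 / det2 w2 w3) *\<^sub>R w2 + (- det2 w2 w1 / det2 w2 w3) *\<^sub>R w3"
    using arg_cong[OF cramer_coordinates[OF d, of w1], of uminus] by simp
  moreover have "- det2 w1 w3 / det2 w2 w3 > 0" "- det2 w2 w1 / det2 w2 w3 > 0"
    using s by (auto simp: field_simps)
  ultimately show ?thesis using d by blast
qed

lemma half_line_iff: "u \<in> half_line v \<longleftrightarrow> (\<exists>t\<ge>0. u = t *\<^sub>R v)"
  by (auto simp: half_line_def)

lemma cone2_dependent:
  assumes "v \<noteq> 0" "w \<noteq> 0" "det2 v w = 0"
  shows "cone2 v w \<subseteq> half_line v \<union> half_line w"
proof
  fix u assume "u \<in> cone2 v w"
  then obtain s t where st: "s \<ge> 0" "t \<ge> 0" and u: "u = s *\<^sub>R v + t *\<^sub>R w"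
    by (auto simp: cone2_def)
  obtain c where c: "w = c *\<^sub>R v" using parallel_if_det2_zero assms by metis
  with assms have "c \<noteq> 0" by auto
  have u1: "u = (s + t * c) *\<^sub>R v" by (simp add: u c algebra_simps)
  have u2: "u = (s / c + t) *\<^sub>R w" using \<open>c \<noteq> 0\<close> by (simp add: u c algebra_simps)
  have "s + t * c \<ge> 0 \<or> s / c + t \<ge> 0"
  proof (cases "s + t * c \<ge> 0")
    case False
    have "t * c \<ge> 0" if "c > 0" using that st by simp
    with False st \<open>c \<noteq> 0\<close> have "c < 0" by (smt (verit))
    moreover have "s / c + t = (s + t * c) / c" using \<open>c \<noteq> 0\<close> by (simp add: field_simps)
    ultimately show ?thesis using False by (simp add: zero_le_divide_iff)
  qed simp
  then show "u \<in> half_line v \<union> half_line w"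
    using u1 u2 by (auto simp: half_line_iff)
qed

text \<open>A vector of the cone that lies on neither bounding ray has positive coordinates, so the
  rays lie on different sides of it.\<close>

lemma oriented_cone:
  assumes "v \<noteq> 0" "w \<noteq> 0" "u \<in> cone2 v w" "u \<notin> half_line v" "u \<notin> half_line w"
  shows "det2 v w \<noteq> 0"
    and "det2 v u * det2 w u < 0"
proof -
  show d: "det2 v w \<noteq> 0" using cone2_dependent assms by blast
  obtain s t where st: "s \<ge> 0" "t \<ge> 0" and u: "u = s *\<^sub>R v + t *\<^sub>R w"
    using assms(3) by (auto simp: cone2_def)
  have "s \<noteq> 0" "t \<noteq> 0" using assms st by (auto simp: u half_line_iff)
  with st have pos: "s > 0" "t > 0" by auto
  have "det2 v u * det2 w u = - (s * t * (det2 v w)\<^sup>2)"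
    by (simp add: u det2_def power2_eq_square algebra_simps)
  then show "det2 v u * det2 w u < 0" using pos d by simp
qed

text \<open>Both \<open>v\<close> and \<open>v'\<close> lie on the same side of \<open>u\<close>, so the one that is closer to \<open>u\<close> belongs to
  the cone bounded by the other one.\<close>

text \<open>A vector \<open>y\<close> on the same side of \<open>u\<close> as the ray \<open>x\<close>, but not behind that ray, lies between
  \<open>x\<close> and \<open>u\<close>: the two determinants are its coordinates in the basis \<open>x\<close>, \<open>u\<close>.\<close>

lemma ray_towards:
  assumes "u \<in> cone2 x z" "det2 y u / det2 x u > 0" "det2 x y / det2 x u \<ge> 0"
  shows "y \<in> cone2 x z"
proof -
  obtain s t where st: "s \<ge> 0" "t \<ge> 0" and u: "u = s *\<^sub>R x + t *\<^sub>R z"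
    using assms(1) by (auto simp: cone2_def)
  define c d where "c = det2 y u / det2 x u" and "d = det2 x y / det2 x u"
  have "det2 x u \<noteq> 0" using assms(2) by auto
  then have "y = c *\<^sub>R x + d *\<^sub>R u"
    unfolding c_def d_def by (rule cramer_coordinates)
  then have "y = (c + d * s) *\<^sub>R x + (d * t) *\<^sub>R z"
    unfolding u by (simp add: algebra_simps)
  moreover have "c + d * s \<ge> 0" "d * t \<ge> 0"
    using st assms(2,3) by (simp_all add: c_def[symmetric] d_def[symmetric])
  ultimately show ?thesis unfolding cone2_def by blast
qed

lemma nested_rays:
  assumes u: "u \<in> cone2 v w" "u \<in> cone2 v' w'"
    and same_side: "det2 v u * det2 v' u > 0"
  shows "v' \<in> cone2 v w \<or> v \<in> cone2 v' w'"
proof -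
  have swap: "det2 v' v = - det2 v v'" by (rule det2_commute)
  have ratios: "det2 v' u / det2 v u > 0" "det2 v u / det2 v' u > 0"
    using same_side by (simp_all add: zero_less_mult_iff zero_less_divide_iff) argo+
  have "det2 v v' / det2 v u \<ge> 0 \<or> det2 v' v / det2 v' u \<ge> 0"
    unfolding swap using same_side by (simp add: zero_less_mult_iff zero_le_divide_iff divide_le_0_iff) argo
  then show ?thesis
    using ray_towards[OF u(1) ratios(1)] ray_towards[OF u(2) ratios(2)] by blast
qed

section \<open>The invariant of the surfaces\<close>

text \<open>An integer vector of length one is a signed unit vector, because its squared entries are
  natural numbers with sum one.\<close>

lemma dist_one_iff:
  "dist (rvec r) (rvec p) = 1 \<longleftrightarrow> (\<exists>i s. \<bar>s\<bar> = 1 \<and> r = p + axis i s)"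
  for r p :: "int ^ 'n::finite"
proof
  assume "dist (rvec r) (rvec p) = 1"
  then have "(\<Sum>i\<in>UNIV. (real_of_int ((r - p) $ i))\<^sup>2) = 1"
    by (simp add: dist_norm norm_vec_def L2_set_def rvec_def real_sqrt_eq_1_iff)
  then have sum1: "(\<Sum>i\<in>UNIV. ((r - p) $ i)\<^sup>2) = 1"
    by (metis (mono_tags, lifting) of_int_1 of_int_eq_iff of_int_power of_int_sum sum.cong)
  then obtain i where i: "(r - p) $ i \<noteq> 0"
    by (metis (no_types, lifting) power_zero_numeral sum.neutral zero_neq_one)
  have split: "((r - p) $ i)\<^sup>2 + (\<Sum>k\<in>UNIV - {i}. ((r - p) $ k)\<^sup>2) = 1"
    using sum1 by (subst (asm) sum.remove[of _ i]) auto
  have ge: "((r - p) $ i)\<^sup>2 \<ge> 1" using i by (metis int_one_le_iff_zero_less zero_less_power2)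
  have rest: "(\<Sum>k\<in>UNIV - {i}. ((r - p) $ k)\<^sup>2) \<ge> 0" by (intro sum_nonneg) auto
  from split ge rest have "((r - p) $ i)\<^sup>2 = 1" "(\<Sum>k\<in>UNIV - {i}. ((r - p) $ k)\<^sup>2) = 0"
    by linarith+
  then have "\<bar>(r - p) $ i\<bar> = 1" and zero: "\<forall>k\<in>UNIV - {i}. ((r - p) $ k)\<^sup>2 = 0"
    by (auto simp: power2_eq_1_iff sum_nonneg_eq_0_iff)
  moreover have "r = p + axis i ((r - p) $ i)"
    using zero by (auto simp: vec_eq_iff axis_def)
  ultimately show "\<exists>i s. \<bar>s\<bar> = 1 \<and> r = p + axis i s" by blast
next
  assume "\<exists>i s. \<bar>s\<bar> = 1 \<and> r = p + axis i s"
  then obtain i s where s: "\<bar>s\<bar> = 1" "r = p + axis i s" by blast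
  have "rvec r - rvec p = real_of_int s *\<^sub>R axis i 1"
    by (auto simp: s rvec_def vec_eq_iff axis_def)
  then have "dist (rvec r) (rvec p) = \<bar>real_of_int s\<bar>" by (simp add: dist_norm norm_axis_1)
  with s show "dist (rvec r) (rvec p) = 1" by (metis of_int_1 of_int_abs)
qed

text \<open>The real plane of \<open>L\<close> is parametrised by \<open>y\<close>, with \<open>y \<bullet> b i\<close> as the \<open>i\<close>-th coordinate. Thus a
  vector \<open>y\<close> moves a point of the plane across grid lines, and \<open>b i\<close> is the normal vector of the
  grid lines \<open>z\<^sub>i = k\<close>.\<close>

locale plane_lattice =
  fixes L :: "(int ^ 'n::finite) set" and b :: "'n \<Rightarrow> real ^ 2"
  assumes zero_mem: "0 \<in> L"
    and add_mem: "\<lbrakk>l \<in> L; l' \<in> L\<rbrakk> \<Longrightarrow> l + l' \<in> L"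
    and uminus_mem: "l \<in> L \<Longrightarrow> - l \<in> L"
    and span_lattice: "span (rvec ` L) = range (\<lambda>y. \<chi> i. y \<bullet> b i)"
    and nonzero: "b i \<noteq> 0"
    and rank: "\<exists>i j. det2 (b i) (b j) \<noteq> 0"
begin

text \<open>If two points of the plane have integer parts \<open>p\<close> and \<open>r\<close>, then the motion \<open>y\<close> from the first to the
  second shows that \<open>r - p\<close> is aligned. An aligned vector cannot cross all three sides of a
  triangle of grid lines outwards.\<close>

definition aligned :: "int ^ 'n \<Rightarrow> bool" where
  "aligned x \<longleftrightarrow> (\<exists>y. \<forall>i. (x $ i > 0 \<longrightarrow> y \<bullet> b i > 0) \<and> (x $ i < 0 \<longrightarrow> y \<bullet> b i < 0))"

text \<open>The first step of a path from \<open>p\<close> to \<open>p + x\<close>. If there is such a step for all pairs of vertices, then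
  any two vertices are connected by a path that crosses no grid line twice.\<close>

definition approach :: "(int ^ 'n) set \<Rightarrow> int ^ 'n \<Rightarrow> int ^ 'n \<Rightarrow> bool" where
  "approach V p x \<longleftrightarrow> (\<exists>i s. \<bar>s\<bar> = 1 \<and> s * x $ i > 0 \<and> p + axis i s \<in> V)"

text \<open>The sector of the square at \<open>p\<close> in the directions \<open>s e\<^sub>i\<close> and \<open>t e\<^sub>j\<close> is its angle at \<open>p\<close> in the
  projection to the dual plane, which maps the two edges to \<open>s b\<^sub>i\<close> and \<open>t b\<^sub>j\<close>.\<close>

definition sector :: "(int ^ 'n) set \<Rightarrow> int ^ 'n \<Rightarrow> 'n \<Rightarrow> int \<Rightarrow> 'n \<Rightarrow> int \<Rightarrow> real ^ 2 \<Rightarrow> bool" where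
  "sector V p i s j t u \<longleftrightarrow> \<bar>s\<bar> = 1 \<and> \<bar>t\<bar> = 1 \<and> det2 (b i) (b j) \<noteq> 0 \<and>
     p + axis i s \<in> V \<and> p + axis j t \<in> V \<and> p + axis i s + axis j t \<in> V \<and>
     u \<in> cone2 (of_int s *\<^sub>R b i) (of_int t *\<^sub>R b j)"

text \<open>The sectors are what the matching consists of. Alignment and approach form one invariant because
  each of them is used to show that the other one survives an elementary transformation.\<close>

definition stepped :: "(int ^ 'n) set \<Rightarrow> bool" where
  "stepped V \<longleftrightarrow>
     (\<forall>p\<in>V. \<forall>l\<in>L. p + l \<in> V) \<and>
     (\<forall>p\<in>V. \<forall>r\<in>V. aligned (r - p)) \<and>
     (\<forall>p\<in>V. \<forall>r\<in>V. p \<noteq> r \<longrightarrow> approach V p (r - p)) \<and>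
     (\<forall>p\<in>V. \<forall>u. u \<noteq> 0 \<longrightarrow> (\<exists>i s j t. sector V p i s j t u))"

lemma stepped_translate: "\<lbrakk>stepped V; p \<in> V; l \<in> L\<rbrakk> \<Longrightarrow> p + l \<in> V"
  by (auto simp: stepped_def)

lemma stepped_aligned: "\<lbrakk>stepped V; p \<in> V; r \<in> V\<rbrakk> \<Longrightarrow> aligned (r - p)"
  by (auto simp: stepped_def)

lemma stepped_approach: "\<lbrakk>stepped V; p \<in> V; r \<in> V; p \<noteq> r\<rbrakk> \<Longrightarrow> approach V p (r - p)"
  by (auto simp: stepped_def)

lemma stepped_sector:
  assumes "stepped V" "p \<in> V" "u \<noteq> 0"
  obtains i s j t where "sector V p i s j t u"
  using assms unfolding stepped_def by blast

lemma lattice_functional: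
  assumes "l \<in> L"
  obtains y where "\<And>i. real_of_int (l $ i) = y \<bullet> b i"
proof -
  have "rvec l \<in> range (\<lambda>y. \<chi> i. y \<bullet> b i)"
    using assms span_lattice by (auto intro: span_base)
  then obtain y where "rvec l = (\<chi> i. y \<bullet> b i)" by auto
  then show ?thesis by (intro that[of y]) (auto simp: rvec_def vec_eq_iff)
qed

lemma diff_mem: "\<lbrakk>l \<in> L; l' \<in> L\<rbrakk> \<Longrightarrow> l - l' \<in> L"
  using add_mem[of l "- l'"] uminus_mem by simp

lemma orbit_iff: "r \<in> orbit L p \<longleftrightarrow> r - p \<in> L"
  by (force simp: orbit_def)

lemma orbit_translate:
  assumes "l \<in> L"
  shows "r + l \<in> orbit L p \<longleftrightarrow> r \<in> orbit L p"
proof -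
  have "r + l - p = (r - p) + l" "r - p = (r + l - p) - l" by simp_all
  then show ?thesis using add_mem diff_mem assms unfolding orbit_iff by metis
qed

lemma orbit_eq:
  assumes "l \<in> L"
  shows "orbit L (p + l) = orbit L p"
proof (rule set_eqI)
  fix r
  have "r - p = (r - (p + l)) + l" "r - (p + l) = (r - p) - l" by simp_all
  then show "r \<in> orbit L (p + l) \<longleftrightarrow> r \<in> orbit L p"
    using add_mem diff_mem assms unfolding orbit_iff by metis
qed

lemma aligned_uminus: "aligned (- x) \<longleftrightarrow> aligned x"
proof -
  have "aligned (- x)" if al: "aligned x" for x
  proof -
    obtain y where "\<forall>i. (x $ i > 0 \<longrightarrow> y \<bullet> b i > 0) \<and> (x $ i < 0 \<longrightarrow> y \<bullet> b i < 0)"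
      using al unfolding aligned_def by blast
    then show ?thesis unfolding aligned_def by (intro exI[of _ "- y"]) auto
  qed
  from this[of x] this[of "- x"] show ?thesis by auto
qed

lemma aligned_lattice: "l \<in> L \<Longrightarrow> aligned l"
  using lattice_functional unfolding aligned_def by (metis of_int_0_less_iff of_int_less_0_iff)

lemma approachI: "\<lbrakk>\<bar>s\<bar> = 1; s * x $ i > 0; p + axis i s \<in> V\<rbrakk> \<Longrightarrow> approach V p x"
  by (auto simp: approach_def)

lemma sector_commute: "sector V p i s j t u \<longleftrightarrow> sector V p j t i s u"
  using det2_commute[of "b i" "b j"]
  by (auto simp: sector_def cone2_commute add.assoc add.commute[of "axis i s"])

lemma abs_one: "\<bar>s\<bar> = 1 \<Longrightarrow> s = 1 \<or> s = - 1" for s :: int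
  by arith

lemma step_nonzero: "\<bar>s\<bar> = 1 \<Longrightarrow> of_int s *\<^sub>R b i \<noteq> 0"
  using nonzero by (auto dest!: abs_one)

text \<open>The sectors at a vertex fill the plane, so the directions of its neighbours
  do not all lie in one closed half-plane.\<close>

lemma neighbours_positively_span:
  assumes "stepped V" "p \<in> V" "y \<noteq> 0"
  shows "\<exists>i s. \<bar>s\<bar> = 1 \<and> p + axis i s \<in> V \<and> of_int s * (y \<bullet> b i) > 0"
proof (rule ccontr)
  assume contra: "\<not> ?thesis"
  obtain i s j t where sec: "sector V p i s j t y"
    using stepped_sector assms by blast
  then obtain \<alpha> \<beta> where "\<alpha> \<ge> 0" "\<beta> \<ge> 0"
    and y: "y = \<alpha> *\<^sub>R (of_int s *\<^sub>R b i) + \<beta> *\<^sub>R (of_int t *\<^sub>R b j)"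
    by (auto simp: sector_def cone2_def)
  have "of_int s * (y \<bullet> b i) \<le> 0" "of_int t * (y \<bullet> b j) \<le> 0"
    using contra sec by (auto simp: sector_def not_less)
  then have "\<alpha> * (of_int s * (y \<bullet> b i)) + \<beta> * (of_int t * (y \<bullet> b j)) \<le> 0"
    using \<open>\<alpha> \<ge> 0\<close> \<open>\<beta> \<ge> 0\<close> by (metis add_nonpos_nonpos mult_nonneg_nonpos)
  moreover have "y \<bullet> y = \<alpha> * (of_int s * (y \<bullet> b i)) + \<beta> * (of_int t * (y \<bullet> b j))"
    by (subst (2) y) (simp add: inner_add_right)
  ultimately show False using \<open>y \<noteq> 0\<close> by (smt (verit) inner_gt_zero_iff)
qed

end

section \<open>Elementary transformations\<close>

text \<open>The situation of an elementary transformation at \<open>p0\<close>: the three neighbours of \<open>p0\<close> lie in the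
  directions \<open>\<sigma> i\<close> along the axes \<open>i \<in> T\<close>, and \<open>p0\<close> is replaced by the opposite vertex \<open>q\<close> of the unit
  cube spanned by these directions. In terms of grid lines, the triangular cell \<open>p0\<close> is inverted.\<close>

locale flip = plane_lattice L b for L :: "(int ^ 'n::finite) set" and b +
  fixes V :: "(int ^ 'n) set" and p0 :: "int ^ 'n" and T :: "'n set" and \<sigma> :: "'n \<Rightarrow> int"
  assumes stepped: "stepped V"
    and mem: "p0 \<in> V"
    and card_T: "card T = 3"
    and sign: "i \<in> T \<Longrightarrow> \<bar>\<sigma> i\<bar> = 1"
    and neighbour_iff: "\<bar>s\<bar> = 1 \<Longrightarrow> p0 + axis i s \<in> V \<longleftrightarrow> i \<in> T \<and> s = \<sigma> i"
    and diagonal: "\<lbrakk>i \<in> T; j \<in> T; i \<noteq> j\<rbrakk> \<Longrightarrow> p0 + axis i (\<sigma> i) + axis j (\<sigma> j) \<in> V"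
begin

definition q :: "int ^ 'n" where
  "q = p0 + (\<chi> i. if i \<in> T then \<sigma> i else 0)"

definition W :: "(int ^ 'n) set" where
  "W = (V - orbit L p0) \<union> orbit L q"

abbreviation v :: "'n \<Rightarrow> real ^ 2" where
  "v i \<equiv> of_int (\<sigma> i) *\<^sub>R b i"

lemma sign_sq: "i \<in> T \<Longrightarrow> \<sigma> i * \<sigma> i = 1"
  using abs_one[OF sign[of i]] by auto

lemma q_nth: "q $ i = p0 $ i + (if i \<in> T then \<sigma> i else 0)"
  by (simp add: q_def)

lemma axis_nth: "axis i s $ k = (if k = i then s else 0)" for s :: int
  by (simp add: axis_def)

lemma finite_T: "finite T" 
  using card_T by (intro card_ge_0_finite) simp

lemma triple:
  assumes "i \<in> T"
  obtains j k where "T = {i, j, k}" "i \<noteq> j" "i \<noteq> k" "j \<noteq> k"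
proof -
  have "card (T - {i}) = 2" using assms card_T finite_T by simp
  then obtain j k where "T - {i} = {j, k}" "j \<noteq> k" by (meson card_2_iff)
  then show ?thesis using assms by (intro that[of j k]) auto
qed

lemma third:
  assumes "i \<in> T" "j \<in> T" "i \<noteq> j"
  obtains k where "T = {i, j, k}" "i \<noteq> k" "j \<noteq> k"
proof -
  obtain j' k' where T: "T = {i, j', k'}" "i \<noteq> j'" "i \<noteq> k'" "j' \<noteq> k'" using triple[OF assms(1)] .
  then consider "j = j'" | "j = k'" using assms by blast
  then show ?thesis
  proof cases
    case 1
    with T show ?thesis by (intro that[of k']) auto
  next
    case 2
    with T show ?thesis by (intro that[of j']) auto
  qed
qed

lemma some_direction:
  assumes "y \<noteq> 0"
  shows "\<exists>i\<in>T. y \<bullet> v i > 0"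
  using neighbours_positively_span[OF stepped mem assms] neighbour_iff by auto

text \<open>The three directions are the outer normals of a triangle.\<close>

lemma relation:
  assumes "T = {i, j, k}"
  shows "det2 (b j) (b k) \<noteq> 0" "\<exists>c>0. \<exists>d>0. - v i = c *\<^sub>R v j + d *\<^sub>R v k"
proof -
  have "y \<bullet> v i > 0 \<or> y \<bullet> v j > 0 \<or> y \<bullet> v k > 0" if "y \<noteq> 0" for y
    using some_direction[OF that] assms by auto
  then have "det2 (v j) (v k) \<noteq> 0 \<and> (\<exists>c>0. \<exists>d>0. - v i = c *\<^sub>R v j + d *\<^sub>R v k)"
    using assms sign by (intro positively_spanning_triple step_nonzero) auto
  then show "det2 (b j) (b k) \<noteq> 0" "\<exists>c>0. \<exists>d>0. - v i = c *\<^sub>R v j + d *\<^sub>R v k"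
    by (auto simp: det2_scale)
qed

text \<open>For a vertex beyond all three lines, alignment with \<open>p0\<close> would provide a vector \<open>y\<close> that is
  positive on three positively spanning directions; then \<open>- y\<close> contradicts the spanning.\<close>

lemma behind:
  assumes "r \<in> V"
  shows "\<exists>i\<in>T. \<sigma> i * (r $ i - p0 $ i) \<le> 0"
proof (rule ccontr)
  assume "\<not> ?thesis"
  then have pos: "\<sigma> i * (r - p0) $ i > 0" if "i \<in> T" for i using that by auto
  obtain y where y: "\<And>i. ((r - p0) $ i > 0 \<longrightarrow> y \<bullet> b i > 0) \<and> ((r - p0) $ i < 0 \<longrightarrow> y \<bullet> b i < 0)"
    using stepped_aligned[OF stepped mem assms] unfolding aligned_def by blast
  have yv: "y \<bullet> v i > 0" if "i \<in> T" for i
    using abs_one[OF sign[OF that]] pos[OF that] y[of i] by auto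
  have "T \<noteq> {}" using card_T by auto
  then have "y \<noteq> 0" using yv by force
  then have "\<exists>i\<in>T. (- y) \<bullet> v i > 0" by (intro some_direction) auto
  then show False using yv by fastforce
qed

text \<open>The only neighbours of \<open>p0\<close> lie across the three lines, and the approach to \<open>r\<close> starts with one
  of them.\<close>

lemma ahead:
  assumes "r \<in> V" "r \<noteq> p0"
  shows "\<exists>i\<in>T. \<sigma> i * (r $ i - p0 $ i) > 0"
proof -
  have "approach V p0 (r - p0)" using stepped_approach[OF stepped mem] assms by auto
  then show ?thesis unfolding approach_def using neighbour_iff by auto
qed

lemma lattice_ahead:
  assumes "l \<in> L" "l \<noteq> 0"
  shows "\<exists>i\<in>T. \<sigma> i * l $ i > 0"
  using ahead[of "p0 + l"] stepped_translate[OF stepped mem] assms by auto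

lemma lattice_behind:
  assumes "l \<in> L" "l \<noteq> 0"
  shows "\<exists>i\<in>T. \<sigma> i * l $ i < 0"
  using lattice_ahead[OF uminus_mem[OF assms(1)]] assms by auto

text \<open>A nonzero lattice vector points backwards along one of the three directions. In particular, no
  other corner of the cube spanned by \<open>p0\<close> and \<open>q\<close> belongs to the orbit of \<open>p0\<close>.\<close>

lemma not_in_orbit:
  assumes "r \<noteq> p0" "\<And>i. i \<in> T \<Longrightarrow> \<sigma> i * (r $ i - p0 $ i) \<ge> 0"
  shows "r \<notin> orbit L p0"
proof
  assume "r \<in> orbit L p0"
  then have "r - p0 \<in> L" "r - p0 \<noteq> 0" using assms(1) by (auto simp: orbit_iff)
  then obtain i where "i \<in> T" "\<sigma> i * (r - p0) $ i < 0" using lattice_behind by blast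
  then show False using assms(2)[of i] by simp
qed

lemma W_translate: "\<lbrakk>r \<in> W; l \<in> L\<rbrakk> \<Longrightarrow> r + l \<in> W"
  using orbit_translate stepped_translate[OF stepped] by (auto simp: W_def)

lemma q_mem: "q \<in> W"
  using zero_mem by (auto simp: W_def orbit_iff)

lemma step_mem:
  assumes "i \<in> T"
  shows "p0 + axis i (\<sigma> i) \<in> V" "p0 + axis i (\<sigma> i) \<in> W"
proof -
  show V: "p0 + axis i (\<sigma> i) \<in> V" using neighbour_iff[OF sign[OF assms], of i] assms by simp
  have "\<sigma> i \<noteq> 0" using sign[OF assms] by auto
  then have "p0 + axis i (\<sigma> i) \<noteq> p0" by (simp add: axis_eq_0_iff)
  moreover have "\<sigma> k * ((p0 + axis i (\<sigma> i)) $ k - p0 $ k) \<ge> 0" for k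
    by (auto simp: axis_nth)
  ultimately have "p0 + axis i (\<sigma> i) \<notin> orbit L p0" by (rule not_in_orbit)
  with V show "p0 + axis i (\<sigma> i) \<in> W" by (simp add: W_def)
qed

lemma diagonal_mem:
  assumes "i \<in> T" "j \<in> T" "i \<noteq> j"
  shows "p0 + axis i (\<sigma> i) + axis j (\<sigma> j) \<in> W"
proof -
  have "(p0 + axis i (\<sigma> i) + axis j (\<sigma> j)) $ i \<noteq> p0 $ i"
    using assms sign[of i] by (auto simp: axis_nth)
  then have "p0 + axis i (\<sigma> i) + axis j (\<sigma> j) \<noteq> p0" by metis
  moreover have "\<sigma> k * ((p0 + axis i (\<sigma> i) + axis j (\<sigma> j)) $ k - p0 $ k) \<ge> 0" for k
    using assms by (auto simp: axis_nth)
  ultimately have "p0 + axis i (\<sigma> i) + axis j (\<sigma> j) \<notin> orbit L p0" by (rule not_in_orbit)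
  with diagonal[OF assms] show ?thesis by (simp add: W_def)
qed

lemma q_eq:
  assumes "T = {i, j, k}" "i \<noteq> j" "i \<noteq> k" "j \<noteq> k"
  shows "q = p0 + axis i (\<sigma> i) + axis j (\<sigma> j) + axis k (\<sigma> k)"
proof -
  have T: "m \<in> T \<longleftrightarrow> m = i \<or> m = j \<or> m = k" for m using assms(1) by simp
  have "q $ m = (p0 + axis i (\<sigma> i) + axis j (\<sigma> j) + axis k (\<sigma> k)) $ m" for m
    unfolding q_nth T using assms(2-4)
    by (cases "m = i"; cases "m = j"; cases "m = k") (simp_all add: axis_nth)
  then show ?thesis by (simp add: vec_eq_iff)
qed

lemma axis_uminus: "axis i (- s) = - axis i s" for s :: int
  by (auto simp: vec_eq_iff axis_nth)

lemma q_step: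
  assumes "i \<in> T"
  shows "q + axis i (- \<sigma> i) \<in> V" "q + axis i (- \<sigma> i) \<in> W"
proof -
  obtain j k where T: "T = {i, j, k}" "i \<noteq> j" "i \<noteq> k" "j \<noteq> k" using triple[OF assms] .
  have "q + axis i (- \<sigma> i) = p0 + axis j (\<sigma> j) + axis k (\<sigma> k)"
    by (simp add: q_eq[OF T] axis_uminus)
  then show "q + axis i (- \<sigma> i) \<in> V" "q + axis i (- \<sigma> i) \<in> W"
    using diagonal[of j k] diagonal_mem[of j k] T by auto
qed

lemma W_cases:
  assumes "r \<in> W"
  obtains "r \<in> V" "r \<notin> orbit L p0" | l where "l \<in> L" "r = q + l"
  using assms by (auto simp: W_def orbit_def)

text \<open>The cube around \<open>p0\<close> and \<open>q\<close> offers three predecessors of \<open>q\<close>. One of them is aligned with \<open>p\<close> by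
  a motion that remains valid for \<open>q\<close>.\<close>

lemma aligned_q:
  assumes "p \<in> V" "p \<noteq> p0"
  shows "aligned (q - p)"
proof -
  obtain i where i: "i \<in> T" "\<sigma> i * (p $ i - p0 $ i) > 0" using ahead assms by blast
  \<comment> \<open>Since \<open>p\<close> is already beyond the line \<open>i\<close>, the step along axis \<open>i\<close> to \<open>q\<close> imposes no new sign.\<close>
  have "aligned (q + axis i (- \<sigma> i) - p)"
    using stepped_aligned[OF stepped assms(1) q_step(1)[OF i(1)]] .
  then obtain y where y: "\<And>k. ((q + axis i (- \<sigma> i) - p) $ k > 0 \<longrightarrow> y \<bullet> b k > 0) \<and>
      ((q + axis i (- \<sigma> i) - p) $ k < 0 \<longrightarrow> y \<bullet> b k < 0)"
    unfolding aligned_def by blast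
  have "((q - p) $ k > 0 \<longrightarrow> y \<bullet> b k > 0) \<and> ((q - p) $ k < 0 \<longrightarrow> y \<bullet> b k < 0)" for k
    using y[of k] i abs_one[OF sign[OF i(1)]] by (auto simp: axis_nth q_nth split: if_splits)
  then show ?thesis unfolding aligned_def by blast
qed

lemma aligned_W:
  assumes "p \<in> W" "r \<in> W"
  shows "aligned (r - p)"
proof -
  have key: "aligned (q + l - p)" if "p \<in> V" "p \<notin> orbit L p0" "l \<in> L" for p l
  proof -
    have "p - l \<in> V" using stepped_translate[OF stepped that(1) uminus_mem[OF that(3)]] by simp
    moreover have "p - l \<noteq> p0" using that by (auto simp: orbit_iff)
    ultimately have "aligned (q - (p - l))" by (rule aligned_q)
    then show ?thesis by (simp add: algebra_simps)
  qed
  show ?thesis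
  proof (cases rule: W_cases[OF assms(1)])
    case 1
    show ?thesis
    proof (cases rule: W_cases[OF assms(2)])
      case 1
      with \<open>p \<in> V\<close> show ?thesis using stepped_aligned[OF stepped] by blast
    next
      case (2 l)
      with \<open>p \<in> V\<close> \<open>p \<notin> orbit L p0\<close> show ?thesis using key by simp
    qed
  next
    case (2 l)
    show ?thesis
    proof (cases rule: W_cases[OF assms(2)])
      case 1
      then have "aligned (- (r - p))" using key[of r l] 2 by simp
      then show ?thesis by (simp only: aligned_uminus)
    next
      case (2 l')
      then show ?thesis using \<open>l \<in> L\<close> \<open>p = q + l\<close> diff_mem[of l' l] aligned_lattice by simp
    qed
  qed
qed

lemma W_step:
  assumes "p + axis i s \<in> V"
  shows "p + axis i s \<in> W \<or> (\<exists>l\<in>L. p + axis i s = p0 + l)"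
  using assms by (auto simp: W_def orbit_def)

text \<open>A path towards \<open>r\<close> through \<open>p0\<close> enters the triangle across one side and leaves it across another
  side. After the inversion of the triangle the two sides are crossed in the opposite order.\<close>

lemma approach_old:
  assumes "p \<in> V" "r \<in> V" "r \<notin> orbit L p0" "p \<noteq> r"
  shows "approach W p (r - p)"
proof -
  obtain k t where t: "\<bar>t\<bar> = 1" "t * (r - p) $ k > 0" "p + axis k t \<in> V"
    using stepped_approach[OF stepped assms(1,2,4)] by (auto simp: approach_def)
  show ?thesis
  proof (cases "p + axis k t \<in> W")
    case True
    with t show ?thesis by (intro approachI)
  next
    case False
    then obtain l where l: "l \<in> L" "p + axis k t = p0 + l" using W_step t by blast
    then have p: "p = p0 + axis k (- t) + l"
      by (simp add: axis_uminus algebra_simps)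
    have "p0 + axis k (- t) \<in> V"
      using stepped_translate[OF stepped assms(1) uminus_mem[OF l(1)]] p by simp
    then have k: "k \<in> T" "- t = \<sigma> k" using neighbour_iff[of "- t" k] t(1) by simp_all
    have rl: "r - l \<in> V" "r - l \<noteq> p0"
      using stepped_translate[OF stepped assms(2) uminus_mem[OF l(1)]] assms(3) l
      by (auto simp: orbit_iff)
    obtain j where j: "j \<in> T" "\<sigma> j * ((r - l) $ j - p0 $ j) > 0" using ahead[OF rl] by blast
    have "t = - \<sigma> k" using k by simp
    then have "t * (r - p) $ k = \<sigma> k * \<sigma> k - \<sigma> k * ((r - l) $ k - p0 $ k)"
      unfolding p by (simp add: axis_nth algebra_simps)
    then have "j \<noteq> k" using t(2) j(2) sign_sq[OF k(1)] by auto
    then have "p0 + axis k (\<sigma> k) + axis j (\<sigma> j) + l \<in> W"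
      using W_translate[OF diagonal_mem l(1)] k j by auto
    then have "p + axis j (\<sigma> j) \<in> W" using k p by (simp add: algebra_simps)
    moreover have "\<sigma> j * (r - p) $ j > 0"
      using j \<open>j \<noteq> k\<close> by (simp add: p axis_nth algebra_simps)
    ultimately show ?thesis using sign j by (intro approachI) auto
  qed
qed

text \<open>Some side of the triangle has \<open>p\<close> on its inner side, and it suffices to approach the neighbour of
  \<open>q\<close> across this side. A path that would use a translate of \<open>p0\<close> is rerouted: a nonzero vector of \<open>L\<close>
  points backwards along one of the directions, so another side of the translated triangle
  separates \<open>p\<close> from \<open>q\<close>.\<close>

lemma approach_new:
  assumes "p \<in> V"
  shows "approach W p (q - p)"
proof -
  obtain i where i: "i \<in> T" "\<sigma> i * (p $ i - p0 $ i) \<le> 0" using behind assms by blast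
  let ?r = "q + axis i (- \<sigma> i)"
  show ?thesis
  proof (cases "p = ?r")
    case True
    then have "p + axis i (\<sigma> i) = q" by (simp add: axis_uminus)
    moreover have "\<sigma> i * (q - p) $ i > 0"
      using True sign_sq[OF i(1)] by (simp add: axis_nth)
    ultimately show ?thesis using sign i q_mem by (intro approachI) auto
  next
    case False
    obtain k t where t: "\<bar>t\<bar> = 1" "t * (?r - p) $ k > 0" "p + axis k t \<in> V"
      using stepped_approach[OF stepped assms q_step(1)[OF i(1)] False] by (auto simp: approach_def)
    have toward: "t * (q - p) $ k > 0"
    proof (cases "k = i")
      case True
      then have "t * (p0 $ i - p $ i) > 0" using t(2) i by (simp add: axis_nth q_nth)
      moreover have "t = \<sigma> i"
        using calculation i(2) abs_one[OF t(1)] abs_one[OF sign[OF i(1)]] by auto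
      ultimately show ?thesis
        using True i sign_sq[OF i(1)] by (simp add: q_nth algebra_simps)
    next
      case False
      then show ?thesis using t(2) by (simp add: axis_nth)
    qed
    show ?thesis
    proof (cases "p + axis k t \<in> W")
      case True
      with t toward show ?thesis by (intro approachI)
    next
      case False
      then obtain l where l: "l \<in> L" "p + axis k t = p0 + l" using W_step t by blast
      then have p: "p = p0 + axis k (- t) + l"
        by (simp add: axis_uminus algebra_simps)
      have "p0 + axis k (- t) \<in> V"
        using stepped_translate[OF stepped assms(1) uminus_mem[OF l(1)]] p by simp
      then have k: "k \<in> T" "- t = \<sigma> k" using neighbour_iff[of "- t" k] t(1) by simp_all
      have lk: "\<sigma> k * l $ k > 0"
      proof -
        have "t = - \<sigma> k" using k by simp
        then have "t * (q - p) $ k = \<sigma> k * l $ k"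
          unfolding p k(2) using k(1) by (simp add: q_nth axis_nth algebra_simps)
        with toward show ?thesis by simp
      qed
      then have "l \<noteq> 0" by auto
      then obtain j where j: "j \<in> T" "\<sigma> j * l $ j < 0" using lattice_behind l by blast
      with lk have "j \<noteq> k" by auto
      then have "p0 + axis k (\<sigma> k) + axis j (\<sigma> j) + l \<in> W"
        using W_translate[OF diagonal_mem l(1)] k j by auto
      then have "p + axis j (\<sigma> j) \<in> W" using k p by (simp add: algebra_simps)
      moreover have "\<sigma> j * (q - p) $ j > 0"
        using j \<open>j \<noteq> k\<close> sign_sq[OF j(1)] by (simp add: p q_nth axis_nth algebra_simps)
      ultimately show ?thesis using sign j by (intro approachI) auto
    qed
  qed
qed

lemma approach_translate:
  assumes "approach W p x" "l \<in> L"
  shows "approach W (p + l) x"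
proof -
  obtain i s where "\<bar>s\<bar> = 1" "s * x $ i > 0" "p + axis i s \<in> W"
    using assms(1) by (auto simp: approach_def)
  moreover have "p + l + axis i s = (p + axis i s) + l" by (simp add: algebra_simps)
  ultimately have "\<bar>s\<bar> = 1" "s * x $ i > 0" "p + l + axis i s \<in> W"
    using W_translate[OF _ assms(2)] by metis+
  then show ?thesis by (rule approachI)
qed

text \<open>Some side of the triangle separates \<open>q\<close> from \<open>r\<close>, because neither an old vertex nor a translate of \<open>q\<close>
  lies beyond all three sides.\<close>

lemma approach_from_q:
  assumes "r \<in> W" "r \<noteq> q"
  shows "approach W q (r - q)"
proof -
  have "\<exists>i\<in>T. \<sigma> i * (r - q) $ i < 0"
  proof (cases rule: W_cases[OF assms(1)])
    case 1
    then obtain i where i: "i \<in> T" "\<sigma> i * (r $ i - p0 $ i) \<le> 0" using behind by blast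
    have "\<sigma> i * (r - q) $ i = \<sigma> i * (r $ i - p0 $ i) - \<sigma> i * \<sigma> i"
      using i by (simp add: q_nth algebra_simps)
    with i sign_sq show ?thesis by (intro bexI[of _ i]) auto
  next
    case (2 l)
    then show ?thesis using lattice_behind[of l] assms by auto
  qed
  then obtain i where i: "i \<in> T" "\<sigma> i * (r - q) $ i < 0" by blast
  moreover have "\<bar>- \<sigma> i\<bar> = 1" using sign[OF i(1)] by simp
  ultimately show ?thesis
    by (intro approachI[of "- \<sigma> i" _ i] q_step) simp_all
qed

lemma approach_W:
  assumes "p \<in> W" "r \<in> W" "p \<noteq> r"
  shows "approach W p (r - p)"
proof (cases rule: W_cases[OF assms(1)])
  case 1
  show ?thesis
  proof (cases rule: W_cases[OF assms(2)])
    case 1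
    with \<open>p \<in> V\<close> show ?thesis using approach_old assms by blast
  next
    case (2 l)
    have "p - l \<in> V" using stepped_translate[OF stepped \<open>p \<in> V\<close> uminus_mem] 2 by simp
    then have "approach W (p - l) (q - (p - l))" by (rule approach_new)
    then have "approach W (p - l + l) (q - (p - l))" using 2 by (intro approach_translate)
    then show ?thesis using 2 by (simp add: algebra_simps)
  qed
next
  case (2 l)
  have "r - l \<in> W" using W_translate[OF assms(2) uminus_mem] 2 by simp
  moreover have "r - l \<noteq> q" using 2 assms(3) by (auto simp: diff_eq_eq)
  ultimately have "approach W q (r - l - q)" by (rule approach_from_q)
  then have "approach W (q + l) (r - l - q)" using 2 by (intro approach_translate)
  then show ?thesis using 2 by (simp add: algebra_simps)
qed

lemma sector_translate:
  assumes "sector W p i s j t u" "l \<in> L"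
  shows "sector W (p + l) i s j t u"
proof -
  have eq: "p + l + axis i s = p + axis i s + l" "p + l + axis j t = p + axis j t + l"
    "p + axis i s + l + axis j t = p + axis i s + axis j t + l"
    by (simp_all add: algebra_simps)
  show ?thesis
    using assms(1) W_translate[OF _ assms(2)] unfolding sector_def eq by blast
qed

text \<open>The sectors at \<open>q\<close> are opposite to those at \<open>p0\<close>.\<close>

lemma sector_at_q:
  assumes "u \<noteq> 0"
  shows "\<exists>i s j t. sector W q i s j t u"
proof -
  obtain i s j t where sec: "sector V p0 i s j t (- u)"
    using stepped_sector[OF stepped mem] assms by (metis neg_equal_0_iff_equal)
  then have ij: "i \<in> T" "s = \<sigma> i" "j \<in> T" "t = \<sigma> j" and d: "det2 (b i) (b j) \<noteq> 0"
    using neighbour_iff[of s i] neighbour_iff[of t j] by (auto simp: sector_def)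
  have "i \<noteq> j" using d by (auto simp: det2_def)
  then obtain k where T: "T = {i, j, k}" "i \<noteq> k" "j \<noteq> k" using third ij by metis
  have "q + axis i (- \<sigma> i) + axis j (- \<sigma> j) = p0 + axis k (\<sigma> k)"
    using q_eq[OF T(1) \<open>i \<noteq> j\<close> T(2,3)] by (simp add: axis_uminus algebra_simps)
  then have "q + axis i (- \<sigma> i) + axis j (- \<sigma> j) \<in> W" using step_mem T by auto
  moreover have "u \<in> cone2 (of_int (- \<sigma> i) *\<^sub>R b i) (of_int (- \<sigma> j) *\<^sub>R b j)"
  proof -
    obtain c d where "c \<ge> 0" "d \<ge> 0" "- u = c *\<^sub>R v i + d *\<^sub>R v j"
      using sec unfolding ij(2,4) sector_def cone2_def by blast
    moreover from this(3) have "u = - (c *\<^sub>R v i + d *\<^sub>R v j)" by (metis minus_minus)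
    then have "u = c *\<^sub>R (of_int (- \<sigma> i) *\<^sub>R b i) + d *\<^sub>R (of_int (- \<sigma> j) *\<^sub>R b j)"
      by simp
    ultimately show ?thesis unfolding cone2_def by blast
  qed
  ultimately have "sector W q i (- \<sigma> i) j (- \<sigma> j) u"
    using q_step ij sign d by (auto simp: sector_def)
  then show ?thesis by blast
qed

text \<open>At a neighbour of \<open>p0\<close> the edge to \<open>p0\<close> disappears, and the two sectors on its sides merge.\<close>

lemma sector_merge:
  assumes "i \<in> T" "j \<in> T" "i \<noteq> j" and u: "u \<in> cone2 (- v i) (v j)"
  shows "\<exists>k. sector W (p0 + axis i (\<sigma> i)) j (\<sigma> j) k (\<sigma> k) u"
proof -
  obtain k where T: "T = {i, j, k}" "i \<noteq> k" "j \<noteq> k" using third assms by metis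
  obtain c d where cd: "c > 0" "d > 0" "- v i = c *\<^sub>R v j + d *\<^sub>R v k"
    using relation(2)[OF T(1)] by blast
  obtain \<alpha> \<beta> where ab: "\<alpha> \<ge> 0" "\<beta> \<ge> 0" "u = \<alpha> *\<^sub>R (- v i) + \<beta> *\<^sub>R v j"
    using u unfolding cone2_def by blast
  have "u = (\<alpha> * c + \<beta>) *\<^sub>R v j + (\<alpha> * d) *\<^sub>R v k"
    by (simp only: ab(3) cd(3)) (simp add: algebra_simps)
  moreover have "\<alpha> * c + \<beta> \<ge> 0" "\<alpha> * d \<ge> 0" using ab cd by auto
  ultimately have "u \<in> cone2 (v j) (v k)" unfolding cone2_def by blast
  moreover have "p0 + axis i (\<sigma> i) + axis j (\<sigma> j) + axis k (\<sigma> k) \<in> W"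
    using q_mem q_eq[OF T(1) assms(3) T(2,3)] by simp
  ultimately have "sector W (p0 + axis i (\<sigma> i)) j (\<sigma> j) k (\<sigma> k) u"
    using T assms sign diagonal_mem relation(1)[OF T(1)] by (auto simp: sector_def)
  then show ?thesis by blast
qed

text \<open>Opposite to \<open>p0\<close> the new edge splits the old sector.\<close>

lemma sector_split:
  assumes "i \<in> T" "j \<in> T" "i \<noteq> j" and u: "u \<in> cone2 (- v i) (- v j)"
  shows "\<exists>m k. sector W (p0 + axis i (\<sigma> i) + axis j (\<sigma> j)) m (- \<sigma> m) k (\<sigma> k) u"
proof -
  obtain k where T: "T = {i, j, k}" "i \<noteq> k" "j \<noteq> k" using third assms by metis
  have T': "T = {k, i, j}" using T by auto
  obtain c d where cd: "c > 0" "d > 0" "- v k = c *\<^sub>R v i + d *\<^sub>R v j"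
    using relation(2)[OF T'] by blast
  from this(3) have "v k = - (c *\<^sub>R v i + d *\<^sub>R v j)" by (metis minus_minus)
  then have vk: "v k = c *\<^sub>R (- v i) + d *\<^sub>R (- v j)" by simp
  obtain \<alpha> \<beta> where ab: "\<alpha> \<ge> 0" "\<beta> \<ge> 0" "u = \<alpha> *\<^sub>R (- v i) + \<beta> *\<^sub>R (- v j)"
    using u unfolding cone2_def by blast
  let ?p = "p0 + axis i (\<sigma> i) + axis j (\<sigma> j)"
  have pk: "?p + axis k (\<sigma> k) \<in> W"
    using q_mem q_eq[OF T(1) assms(3) T(2,3)] by simp
  have k: "k \<in> T" using T by simp
  have i: "?p + axis i (- \<sigma> i) = p0 + axis j (\<sigma> j)"
    and j: "?p + axis j (- \<sigma> j) = p0 + axis i (\<sigma> i)"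
    by (simp_all add: axis_uminus algebra_simps)
  have mem: "?p + axis i (- \<sigma> i) \<in> W" "?p + axis j (- \<sigma> j) \<in> W"
    "?p + axis i (- \<sigma> i) + axis k (\<sigma> k) \<in> W" "?p + axis j (- \<sigma> j) + axis k (\<sigma> k) \<in> W"
    unfolding i j using assms k T step_mem diagonal_mem by blast+
  have abs: "\<bar>- \<sigma> i\<bar> = 1" "\<bar>- \<sigma> j\<bar> = 1" "\<bar>\<sigma> k\<bar> = 1" using sign assms k by simp_all
  have det: "det2 (b i) (b k) \<noteq> 0" "det2 (b j) (b k) \<noteq> 0"
    using relation(1)[of j i k] relation(1)[of i j k] T by auto
  show ?thesis
  proof (cases "\<alpha> / c \<ge> \<beta> / d")
    case True
    have "u = (\<alpha> - c * (\<beta> / d)) *\<^sub>R (- v i) + (\<beta> / d) *\<^sub>R v k"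
      unfolding ab(3) vk using cd by (simp add: algebra_simps)
    moreover have "\<alpha> - c * (\<beta> / d) \<ge> 0" "\<beta> / d \<ge> 0"
      using True ab cd by (auto simp: field_simps)
    ultimately have "u \<in> cone2 (- v i) (v k)" unfolding cone2_def by blast
    then have "sector W ?p i (- \<sigma> i) k (\<sigma> k) u"
      using abs mem pk det by (simp add: sector_def)
    then show ?thesis by blast
  next
    case False
    have "u = (\<beta> - d * (\<alpha> / c)) *\<^sub>R (- v j) + (\<alpha> / c) *\<^sub>R v k"
      unfolding ab(3) vk using cd by (simp add: algebra_simps)
    moreover have "\<beta> - d * (\<alpha> / c) \<ge> 0" "\<alpha> / c \<ge> 0"
      using False ab cd by (auto simp: field_simps)
    ultimately have "u \<in> cone2 (- v j) (v k)" unfolding cone2_def by blast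
    then have "sector W ?p j (- \<sigma> j) k (\<sigma> k) u"
      using abs mem pk det by (simp add: sector_def)
    then show ?thesis by blast
  qed
qed

lemma back_mem: "\<lbrakk>r \<in> V; l \<in> L\<rbrakk> \<Longrightarrow> r - l \<in> V"
  using stepped_translate[OF stepped _ uminus_mem, of r l] by simp

lemma sector_beside:
  assumes "p \<in> V" "sector V p i s j t u" "p + axis i s = p0 + l" "l \<in> L"
  shows "\<exists>i s j t. sector W p i s j t u"
proof -
  have p: "p - l = p0 + axis i (- s)" using assms(3) by (simp add: axis_uminus algebra_simps)
  have "p0 + axis i (- s) \<in> V" using back_mem[OF assms(1,4)] unfolding p .
  then have i: "i \<in> T" "s = - \<sigma> i" using neighbour_iff[of "- s" i] assms(2) by (auto simp: sector_def)
  have "p + axis i s + axis j t - l = p0 + axis j t" using assms(3) by (simp add: algebra_simps)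
  moreover have "p + axis i s + axis j t - l \<in> V"
    using back_mem[OF _ assms(4)] assms(2) by (simp add: sector_def)
  ultimately have "p0 + axis j t \<in> V" by metis
  then have j: "j \<in> T" "t = \<sigma> j" using neighbour_iff[of t j] assms(2) by (auto simp: sector_def)
  have "i \<noteq> j" "u \<in> cone2 (- v i) (v j)"
    using assms(2) i j by (auto simp: sector_def det2_def)
  then obtain k where "sector W (p0 + axis i (\<sigma> i)) j (\<sigma> j) k (\<sigma> k) u"
    using sector_merge i j by blast
  then have "sector W (p - l) j (\<sigma> j) k (\<sigma> k) u"
    unfolding p using i by simp
  then have "sector W (p - l + l) j (\<sigma> j) k (\<sigma> k) u"
    using assms(4) by (rule sector_translate)
  then show ?thesis by auto
qed

lemma sector_opposite:
  assumes "p \<in> V" "sector V p i s j t u" "p + axis i s + axis j t = p0 + l" "l \<in> L"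
  shows "\<exists>i s j t. sector W p i s j t u"
proof -
  have "p + axis i s - l = p0 + axis j (- t)" "p + axis j t - l = p0 + axis i (- s)"
    and p: "p - l = p0 + axis i (- s) + axis j (- t)"
    using assms(3) by (simp_all add: axis_uminus algebra_simps)
  moreover have "p + axis i s - l \<in> V" "p + axis j t - l \<in> V"
    using back_mem[OF _ assms(4)] assms(2) by (simp_all add: sector_def)
  ultimately have "p0 + axis i (- s) \<in> V" "p0 + axis j (- t) \<in> V" by simp_all
  then have ij: "i \<in> T" "s = - \<sigma> i" "j \<in> T" "t = - \<sigma> j"
    using neighbour_iff[of "- s" i] neighbour_iff[of "- t" j] assms(2) by (auto simp: sector_def)
  have "i \<noteq> j" "u \<in> cone2 (- v i) (- v j)"
    using assms(2) ij by (auto simp: sector_def det2_def)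
  then obtain m k where "sector W (p0 + axis i (\<sigma> i) + axis j (\<sigma> j)) m (- \<sigma> m) k (\<sigma> k) u"
    using sector_split ij by blast
  then have "sector W (p - l) m (- \<sigma> m) k (\<sigma> k) u"
    unfolding p using ij by simp
  then have "sector W (p - l + l) m (- \<sigma> m) k (\<sigma> k) u"
    using assms(4) by (rule sector_translate)
  then show ?thesis by auto
qed

lemma sector_W:
  assumes "p \<in> W" "u \<noteq> 0"
  shows "\<exists>i s j t. sector W p i s j t u"
proof (cases rule: W_cases[OF assms(1)])
  case 1
  obtain i s j t where sec: "sector V p i s j t u"
    using stepped_sector[OF stepped \<open>p \<in> V\<close> assms(2)] .
  then have mem: "p + axis i s \<in> V" "p + axis j t \<in> V" "p + axis i s + axis j t \<in> V"
    by (auto simp: sector_def)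
  consider "p + axis i s \<in> W" "p + axis j t \<in> W" "p + axis i s + axis j t \<in> W"
    | l where "l \<in> L" "p + axis i s = p0 + l"
    | l where "l \<in> L" "p + axis j t = p0 + l"
    | l where "l \<in> L" "p + axis i s + axis j t = p0 + l"
    using W_step[OF mem(1)] W_step[OF mem(2)] W_step[OF mem(3)] by blast
  then show ?thesis
  proof cases
    case 1
    with sec have "sector W p i s j t u" by (simp add: sector_def)
    then show ?thesis by blast
  next
    case 2
    then show ?thesis using sector_beside[OF \<open>p \<in> V\<close> sec] by blast
  next
    case 3
    have "sector V p j t i s u" using sec by (simp only: sector_commute)
    with 3 show ?thesis using sector_beside[OF \<open>p \<in> V\<close>] by blast
  next
    case 4
    then show ?thesis using sector_opposite[OF \<open>p \<in> V\<close> sec] by blast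
  qed
next
  case (2 l)
  then show ?thesis using sector_at_q[OF assms(2)] sector_translate by blast
qed

lemma stepped_W: "stepped W"
  unfolding stepped_def using W_translate aligned_W approach_W sector_W by blast

end

text \<open>The three neighbours in an elementary transformation automatically lie in three different
  coordinate directions, because these directions span the plane positively.\<close>

lemma (in plane_lattice) stepped_elementary_transformation:
  assumes "stepped V" "elementary_transformation L V V'"
  shows "stepped V'"
proof -
  obtain p0 p1 p2 p3 where p: "p0 \<in> V"
    and near: "{q \<in> V. dist (rvec q) (rvec p0) = 1} = {p1, p2, p3}"
    and distinct: "p1 \<noteq> p2" "p1 \<noteq> p3" "p2 \<noteq> p3"
    and diag: "p1 + p2 - p0 \<in> V" "p1 + p3 - p0 \<in> V" "p2 + p3 - p0 \<in> V"
    and V': "V' = (V - orbit L p0) \<union> orbit L (p1 + p2 + p3 - 2 *s p0)"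
    using assms(2) unfolding elementary_transformation_def by blast
  have neighbour: "q \<in> V \<and> dist (rvec q) (rvec p0) = 1 \<longleftrightarrow> q = p1 \<or> q = p2 \<or> q = p3" for q
    using near by blast
  obtain i1 s1 where 1: "\<bar>s1\<bar> = 1" "p1 = p0 + axis i1 s1"
    using neighbour[of p1] dist_one_iff by blast
  obtain i2 s2 where 2: "\<bar>s2\<bar> = 1" "p2 = p0 + axis i2 s2"
    using neighbour[of p2] dist_one_iff by blast
  obtain i3 s3 where 3: "\<bar>s3\<bar> = 1" "p3 = p0 + axis i3 s3"
    using neighbour[of p3] dist_one_iff by blast
  have steps: "p0 + axis i s \<in> V \<longleftrightarrow> (i, s) \<in> {(i1, s1), (i2, s2), (i3, s3)}"
    if "\<bar>s\<bar> = 1" for i s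
  proof -
    have "dist (rvec (p0 + axis i s)) (rvec p0) = 1" using that dist_one_iff by blast
    then have "p0 + axis i s \<in> V \<longleftrightarrow> axis i s = axis i1 s1 \<or> axis i s = axis i2 s2 \<or> axis i s = axis i3 s3"
      using neighbour[of "p0 + axis i s"] unfolding 1(2) 2(2) 3(2) by simp
    moreover have "axis i s = axis i' s' \<longleftrightarrow> (i, s) = (i', s')" for i' s'
      using that by (auto simp: axis_eq_axis)
    ultimately show ?thesis by blast
  qed
  have span: "y \<bullet> (of_int s1 *\<^sub>R b i1) > 0 \<or> y \<bullet> (of_int s2 *\<^sub>R b i2) > 0 \<or> y \<bullet> (of_int s3 *\<^sub>R b i3) > 0"
    if "y \<noteq> 0" for y
    using neighbours_positively_span[OF assms(1) p that] by (auto simp: steps)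
  have "det2 (of_int s2 *\<^sub>R b i2) (of_int s3 *\<^sub>R b i3) \<noteq> 0"
    "det2 (of_int s1 *\<^sub>R b i1) (of_int s3 *\<^sub>R b i3) \<noteq> 0"
    "det2 (of_int s1 *\<^sub>R b i1) (of_int s2 *\<^sub>R b i2) \<noteq> 0"
    using positively_spanning_triple[of "of_int s1 *\<^sub>R b i1" "of_int s2 *\<^sub>R b i2" "of_int s3 *\<^sub>R b i3"]
      positively_spanning_triple[of "of_int s2 *\<^sub>R b i2" "of_int s1 *\<^sub>R b i1" "of_int s3 *\<^sub>R b i3"]
      positively_spanning_triple[of "of_int s3 *\<^sub>R b i3" "of_int s1 *\<^sub>R b i1" "of_int s2 *\<^sub>R b i2"]
      step_nonzero[OF 1(1)] step_nonzero[OF 2(1)] step_nonzero[OF 3(1)] span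
    by blast+
  then have ne: "i1 \<noteq> i2" "i1 \<noteq> i3" "i2 \<noteq> i3" by (auto simp: det2_def)
  define \<sigma> where "\<sigma> = (\<lambda>i. if i = i1 then s1 else if i = i2 then s2 else s3)"
  have \<sigma>: "\<sigma> i1 = s1" "\<sigma> i2 = s2" "\<sigma> i3 = s3" using ne by (auto simp: \<sigma>_def)
  have d: "p0 + axis i1 s1 + axis i2 s2 \<in> V" "p0 + axis i1 s1 + axis i3 s3 \<in> V"
    "p0 + axis i2 s2 + axis i3 s3 \<in> V"
    using diag by (simp_all add: 1 2 3 algebra_simps)
  have d': "p0 + axis i2 s2 + axis i1 s1 \<in> V" "p0 + axis i3 s3 + axis i1 s1 \<in> V"
    "p0 + axis i3 s3 + axis i2 s2 \<in> V"
    using d by (simp_all add: ac_simps)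
  interpret flip L b V p0 "{i1, i2, i3}" \<sigma>
  proof
    show "stepped V" "p0 \<in> V" by fact+
    show "card {i1, i2, i3} = 3" using ne by simp
    show "\<bar>\<sigma> i\<bar> = 1" if "i \<in> {i1, i2, i3}" for i using that 1 2 3 \<sigma> by auto
    show "p0 + axis i s \<in> V \<longleftrightarrow> i \<in> {i1, i2, i3} \<and> s = \<sigma> i" if "\<bar>s\<bar> = 1" for i s
      using steps[OF that] \<sigma> by auto
    show "p0 + axis i (\<sigma> i) + axis j (\<sigma> j) \<in> V"
      if "i \<in> {i1, i2, i3}" "j \<in> {i1, i2, i3}" "i \<noteq> j" for i j
      using that d d' \<sigma> by auto
  qed
  have "2 *s p0 = p0 + p0" by (simp add: vec_eq_iff)
  then have "p1 + p2 + p3 - 2 *s p0 = q"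
    using q_eq[OF refl ne] by (simp add: 1 2 3 \<sigma> algebra_simps)
  then have "V' = W" unfolding V' W_def by simp
  then show ?thesis using stepped_W by simp
qed

section \<open>Surfaces of line arrangements\<close>

lemma eventually_stays_above:
  fixes w c p :: real
  assumes "p \<le> w" "w = p \<Longrightarrow> c \<ge> 0"
  shows "\<forall>\<^sub>F \<epsilon> in at_right 0. p \<le> w + \<epsilon> * c"
proof (cases "w = p")
  case True
  then show ?thesis
    using assms by (intro eventually_mono[OF eventually_at_right_less]) auto
next
  case False
  have "((\<lambda>\<epsilon>. w + \<epsilon> * c) \<longlongrightarrow> w + 0 * c) (at_right 0)" by (intro tendsto_intros)
  then have "\<forall>\<^sub>F \<epsilon> in at_right 0. p < w + \<epsilon> * c"
    using False assms by (intro order_tendstoD) auto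
  then show ?thesis by (rule eventually_mono) simp
qed

lemma eventually_stays_below:
  fixes w c p :: real
  assumes "w \<le> p" "w = p \<Longrightarrow> c \<le> 0"
  shows "\<forall>\<^sub>F \<epsilon> in at_right 0. w + \<epsilon> * c \<le> p"
proof -
  have "\<forall>\<^sub>F \<epsilon> in at_right 0. - p \<le> - w + \<epsilon> * (- c)"
    using assms by (intro eventually_stays_above) auto
  then show ?thesis by (rule eventually_mono) simp
qed

lemma eventually_goes_below:
  fixes w c p :: real
  assumes "w \<le> p" "w = p \<Longrightarrow> c < 0"
  shows "\<forall>\<^sub>F \<epsilon> in at_right 0. w + \<epsilon> * c < p"
proof (cases "w = p")
  case True
  then show ?thesis
    using assms
    by (intro eventually_mono[OF eventually_at_right_less]) (auto simp: mult_pos_neg)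
next
  case False
  have "((\<lambda>\<epsilon>. w + \<epsilon> * c) \<longlongrightarrow> w + 0 * c) (at_right 0)" by (intro tendsto_intros)
  then show ?thesis using False assms by (intro order_tendstoD) auto
qed

context plane_lattice
begin

lemma real_plane_iff: "z \<in> real_plane L lam \<longleftrightarrow> (\<exists>y. \<forall>i. z $ i = lam $ i + y \<bullet> b i)"
proof -
  have "real_plane L lam = range (\<lambda>y. lam + (\<chi> i. y \<bullet> b i))"
    by (auto simp: real_plane_def span_lattice)
  then show ?thesis by (auto simp: vec_eq_iff)
qed

lemma real_plane_shift:
  assumes "w \<in> real_plane L lam"
  shows "w + (\<chi> i. y \<bullet> b i) \<in> real_plane L lam"
proof -
  obtain y' where "\<And>i. w $ i = lam $ i + y' \<bullet> b i" using assms real_plane_iff by auto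
  then have "\<forall>i. (w + (\<chi> i. y \<bullet> b i)) $ i = lam $ i + (y' + y) \<bullet> b i"
    by (simp add: inner_add_left)
  then show ?thesis unfolding real_plane_iff by blast
qed

lemma real_plane_difference:
  assumes "z \<in> real_plane L lam" "z' \<in> real_plane L lam"
  obtains y where "\<And>i. z' $ i - z $ i = y \<bullet> b i"
proof -
  obtain y y' where "\<And>i. z $ i = lam $ i + y \<bullet> b i" "\<And>i. z' $ i = lam $ i + y' \<bullet> b i"
    using assms real_plane_iff by auto
  then show ?thesis by (intro that[of "y' - y"]) (simp add: inner_diff_left)
qed

lemma card_integer_coordinates:
  assumes "non_resonant L lam" "w \<in> real_plane L lam"
  shows "card {i. w $ i \<in> \<int>} \<le> 2"
proof -
  have "{(i, k). w \<in> grid_line L lam i k} = (\<lambda>i. (i, \<lfloor>w $ i\<rfloor>)) ` {i. w $ i \<in> \<int>}"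
    using assms(2) by (auto simp: grid_line_def image_iff elim!: Ints_cases)
  then have "card {(i, k). w \<in> grid_line L lam i k} = card {i. w $ i \<in> \<int>}"
    by (simp add: card_image inj_on_def)
  then show ?thesis using assms(1) unfolding non_resonant_def by metis
qed

text \<open>Two grid lines through a common point are transversal: if they coincided, they would meet
  some third grid line.\<close>

lemma integer_coordinates_independent:
  assumes "non_resonant L lam" "w \<in> real_plane L lam"
    and "i \<noteq> j" "w $ i \<in> \<int>" "w $ j \<in> \<int>"
  shows "det2 (b i) (b j) \<noteq> 0"
proof
  assume par: "det2 (b i) (b j) = 0"
  then obtain c where c: "b j = c *\<^sub>R b i" using parallel_if_det2_zero nonzero by metis
  have "\<exists>m. det2 (b i) (b m) \<noteq> 0"
  proof (rule ccontr)
    assume "\<not> ?thesis"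
    then have "\<exists>d. b m = d *\<^sub>R b i" for m using parallel_if_det2_zero nonzero by metis
    then have "det2 (b m) (b m') = 0" for m m' by (metis det2_scale mult_zero_right det2_def diff_self mult.commute)
    then show False using rank by blast
  qed
  then obtain m where m: "det2 (b i) (b m) \<noteq> 0" by blast
  then have "m \<noteq> i" "m \<noteq> j" using par by (auto simp: det2_def)
  obtain y where y: "y \<bullet> b i = 0" "y \<bullet> b m = of_int \<lfloor>w $ m\<rfloor> - w $ m"
    using prescribed_inner_products[OF m] by metis
  let ?w = "w + (\<chi> i. y \<bullet> b i)"
  have "?w $ i \<in> \<int>" "?w $ j \<in> \<int>" "?w $ m \<in> \<int>" using y assms by (simp_all add: c)
  then have "card {i, j, m} \<le> card {i. ?w $ i \<in> \<int>}" by (intro card_mono) auto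
  also have "\<dots> \<le> 2" using card_integer_coordinates assms(1) real_plane_shift[OF assms(2)] by blast
  finally show False using \<open>i \<noteq> j\<close> \<open>m \<noteq> i\<close> \<open>m \<noteq> j\<close> by simp
qed

lemma integer_coordinates_cases:
  assumes "non_resonant L lam" "w \<in> real_plane L lam"
  obtains i where "{i. w $ i \<in> \<int>} \<subseteq> {i}"
  | i j where "{i. w $ i \<in> \<int>} = {i, j}" "i \<noteq> j" "det2 (b i) (b j) \<noteq> 0"
proof -
  let ?I = "{i. w $ i \<in> \<int>}"
  consider "card ?I = 0" | "card ?I = 1" | "card ?I = 2"
    using card_integer_coordinates[OF assms] by linarith
  then show ?thesis
  proof cases
    case 1
    then have "?I = {}" by (simp only: card_0_eq finite)
    then show ?thesis using that(1) by blast
  next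
    case 2
    then show ?thesis using that(1) by (metis card_1_singletonE subset_refl)
  next
    case 3
    then obtain i j where ij: "?I = {i, j}" "i \<noteq> j" by (meson card_2_iff)
    then show ?thesis
      using integer_coordinates_independent[OF assms] that(2) by blast
  qed
qed

text \<open>At most two grid lines pass through a point, and they are transversal. Hence one can leave
  the point into any of the cells around it.\<close>

lemma vertex_if_in_closed_cell:
  assumes "non_resonant L lam" "w \<in> real_plane L lam"
    and cell: "\<And>k. of_int (p $ k) \<le> w $ k \<and> w $ k \<le> of_int (p $ k) + 1"
  shows "p \<in> floor_vec ` real_plane L lam"
proof -
  define s where "s k = (if w $ k = of_int (p $ k) then 1 else - 1 :: real)" for k
  have "\<exists>y. \<forall>i. w $ i \<in> \<int> \<longrightarrow> s i * (y \<bullet> b i) > 0"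
  proof (cases rule: integer_coordinates_cases[OF assms(1,2)])
    case (1 i)
    have "s i * ((s i *\<^sub>R b i) \<bullet> b i) > 0" using nonzero by (simp add: s_def)
    with 1 show ?thesis by blast
  next
    case (2 i j)
    obtain y where "y \<bullet> b i = s i" "y \<bullet> b j = s j" using prescribed_inner_products 2(3) by metis
    then have "s i * (y \<bullet> b i) > 0" "s j * (y \<bullet> b j) > 0" by (auto simp: s_def)
    then have "s k * (y \<bullet> b k) > 0" if "w $ k \<in> \<int>" for k
      using 2(1) that by (cases "k = i") auto
    then show ?thesis by blast
  qed
  then obtain y where y: "\<And>i. w $ i \<in> \<int> \<Longrightarrow> s i * (y \<bullet> b i) > 0" by blast
  have "\<forall>\<^sub>F \<epsilon> in at_right 0. of_int (p $ k) \<le> w $ k + \<epsilon> * (y \<bullet> b k) \<and>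
      w $ k + \<epsilon> * (y \<bullet> b k) < of_int (p $ k) + 1" for k
  proof (intro eventually_conj eventually_stays_above eventually_goes_below)
    assume "w $ k = of_int (p $ k)"
    then show "y \<bullet> b k \<ge> 0" using y[of k] by (simp add: s_def)
  next
    assume "w $ k = of_int (p $ k) + 1"
    then have "w $ k \<in> \<int>" "s k = - 1" by (simp_all add: s_def)
    then show "y \<bullet> b k < 0" using y[of k] by simp
  qed (use cell in auto)
  then have "\<forall>\<^sub>F \<epsilon> in at_right 0. \<forall>k. of_int (p $ k) \<le> w $ k + \<epsilon> * (y \<bullet> b k) \<and>
      w $ k + \<epsilon> * (y \<bullet> b k) < of_int (p $ k) + 1"
    by (rule eventually_all_finite)
  then obtain \<epsilon> where \<epsilon>: "\<And>k. of_int (p $ k) \<le> w $ k + \<epsilon> * (y \<bullet> b k) \<and>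
      w $ k + \<epsilon> * (y \<bullet> b k) < of_int (p $ k) + 1"
    using eventually_happens[of _ "at_right (0::real)"] by fastforce
  let ?z = "w + (\<chi> i. (\<epsilon> *\<^sub>R y) \<bullet> b i)"
  have "floor_vec ?z = p"
    using \<epsilon> by (auto simp: floor_vec_def vec_eq_iff intro!: floor_unique)
  moreover have "?z \<in> real_plane L lam" by (rule real_plane_shift) fact
  ultimately show ?thesis by blast
qed

text \<open>On the segment from \<open>z\<close> to \<open>z'\<close>, the first grid line at which the segment leaves the closed cell
  of \<open>z\<close> can be crossed: the point where this happens also belongs to the closed cell beyond.\<close>

lemma approach_initial:
  assumes nr: "non_resonant L lam" and z: "z \<in> real_plane L lam" "z' \<in> real_plane L lam"
    and ne: "floor_vec z \<noteq> floor_vec z'"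
  shows "approach (floor_vec ` real_plane L lam) (floor_vec z) (floor_vec z' - floor_vec z)"
proof -
  define p r where "p = floor_vec z" and "r = floor_vec z'"
  have p: "of_int (p $ k) \<le> z $ k \<and> z $ k < of_int (p $ k) + 1"
    and r: "of_int (r $ k) \<le> z' $ k \<and> z' $ k < of_int (r $ k) + 1" for k
    by (simp_all add: p_def r_def floor_vec_def)
  \<comment> \<open>The time at which the segment from \<open>z\<close> to \<open>z'\<close> leaves the strip of \<open>p\<close> in direction \<open>k\<close>.\<close>
  define \<tau> where "\<tau> k = (if r $ k > p $ k then (of_int (p $ k) + 1 - z $ k) / (z' $ k - z $ k)
      else (z $ k - of_int (p $ k)) / (z $ k - z' $ k))" for k
  define D where "D = {k. p $ k \<noteq> r $ k}"
  have "D \<noteq> {}" using ne by (auto simp: D_def p_def r_def vec_eq_iff)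
  then obtain i where i: "i \<in> D" "\<And>k. k \<in> D \<Longrightarrow> \<tau> i \<le> \<tau> k"
    using ex_min_if_finite[of "\<tau> ` D"] by (auto simp: not_less) 
  have up: "of_int (p $ k) + 1 \<le> z' $ k" if "r $ k > p $ k" for k
  proof -
    have "of_int (p $ k) + 1 \<le> real_of_int (r $ k)" using that by linarith
    with r[of k] show ?thesis by linarith
  qed
  have down: "z' $ k < of_int (p $ k)" if "r $ k < p $ k" for k
  proof -
    have "of_int (r $ k) + 1 \<le> real_of_int (p $ k)" using that by linarith
    with r[of k] show ?thesis by linarith
  qed
  have \<tau>: "\<tau> k \<ge> 0" "\<tau> k \<le> 1" if k: "k \<in> D" for k
  proof -
    consider "r $ k > p $ k" | "r $ k < p $ k" using k unfolding D_def by fastforce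
    then have "\<tau> k \<ge> 0 \<and> \<tau> k \<le> 1"
    proof cases
      case 1
      with up[of k] p[of k] show ?thesis by (simp add: \<tau>_def)
    next
      case 2
      with down[of k] p[of k] show ?thesis by (simp add: \<tau>_def)
    qed
    then show "\<tau> k \<ge> 0" "\<tau> k \<le> 1" by auto
  qed
  have cross: "z $ k + \<tau> k * (z' $ k - z $ k) = of_int (p $ k) + (if r $ k > p $ k then 1 else 0)"
    if k: "k \<in> D" for k
  proof -
    consider "r $ k > p $ k" | "r $ k < p $ k" using k unfolding D_def by fastforce
    then show ?thesis
    proof cases
      case 1
      with up[of k] p[of k] show ?thesis by (simp add: \<tau>_def)
    next
      case 2
      then have "\<tau> k * (z $ k - z' $ k) = z $ k - of_int (p $ k)"
        using down[of k] p[of k] by (simp add: \<tau>_def)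
      with 2 show ?thesis by (simp add: algebra_simps)
    qed
  qed
  obtain y where y: "\<And>k. z' $ k - z $ k = y \<bullet> b k" using real_plane_difference z by blast
  define w where "w = z + (\<chi> k. (\<tau> i *\<^sub>R y) \<bullet> b k)"
  have w: "w \<in> real_plane L lam" unfolding w_def by (rule real_plane_shift) fact
  have w_nth: "w $ k = z $ k + \<tau> i * (z' $ k - z $ k)" for k by (simp add: w_def y)
  have cell: "of_int (p $ k) \<le> w $ k \<and> w $ k \<le> of_int (p $ k) + 1" for k
  proof -
    consider "p $ k = r $ k" | "k \<in> D" "r $ k > p $ k" | "k \<in> D" "r $ k < p $ k"
      by (fastforce simp: D_def)
    then show ?thesis
    proof cases
      case 1
      have "w $ k = (1 - \<tau> i) * z $ k + \<tau> i * z' $ k" by (simp add: w_nth algebra_simps)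
      then show ?thesis
        using convex_bound_le[of "z $ k" "of_int (p $ k) + 1" "z' $ k" "1 - \<tau> i" "\<tau> i"]
          convex_bound_le[of "- z $ k" "- of_int (p $ k)" "- z' $ k" "1 - \<tau> i" "\<tau> i"]
          p[of k] r[of k] 1 \<tau>[OF i(1)]
        by simp
    next
      case 2
      have "\<tau> i * (z' $ k - z $ k) \<ge> 0" "\<tau> i * (z' $ k - z $ k) \<le> \<tau> k * (z' $ k - z $ k)"
        using \<tau>[OF i(1)] i(2)[OF 2(1)] up[OF 2(2)] p[of k]
        by (auto intro!: mult_nonneg_nonneg mult_right_mono)
      then show ?thesis using cross[OF 2(1)] 2(2) p[of k] unfolding w_nth by simp
    next
      case 3
      have "\<tau> i * (z $ k - z' $ k) \<ge> 0" "\<tau> i * (z $ k - z' $ k) \<le> \<tau> k * (z $ k - z' $ k)"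
        using \<tau>[OF i(1)] i(2)[OF 3(1)] down[OF 3(2)] p[of k]
        by (auto intro!: mult_nonneg_nonneg mult_right_mono)
      then have "\<tau> i * (z' $ k - z $ k) \<le> 0" "\<tau> k * (z' $ k - z $ k) \<le> \<tau> i * (z' $ k - z $ k)"
        by (simp_all add: algebra_simps)
      then show ?thesis using cross[OF 3(1)] 3(2) p[of k] unfolding w_nth by simp
    qed
  qed
  define s :: int where "s = (if r $ i > p $ i then 1 else - 1)"
  have wi: "w $ i = of_int (p $ i) + (if r $ i > p $ i then 1 else 0)"
    unfolding w_nth by (rule cross) fact
  have "of_int ((p + axis i s) $ k) \<le> w $ k \<and> w $ k \<le> of_int ((p + axis i s) $ k) + 1" for k
    using cell[of k] wi by (cases "k = i") (auto simp: s_def axis_def)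
  then have "p + axis i s \<in> floor_vec ` real_plane L lam"
    by (rule vertex_if_in_closed_cell[OF nr w])
  moreover have "s * (r - p) $ i > 0" "\<bar>s\<bar> = 1" using i(1) by (auto simp: s_def D_def)
  ultimately show ?thesis unfolding p_def[symmetric] r_def[symmetric] by (intro approachI)
qed

text \<open>The sector at \<open>p\<close> that contains \<open>u\<close> belongs to the corner of the cell of \<open>p\<close> at which
  \<open>u\<close> is maximal. Ties are broken by the perpendicular direction, so that the maximum is attained
  at a corner even if \<open>u\<close> is perpendicular to a side.\<close>

lemma sector_initial:
  assumes nr: "non_resonant L lam" and z: "z \<in> real_plane L lam" and u: "u \<noteq> 0"
  shows "\<exists>i s j t. sector (floor_vec ` real_plane L lam) (floor_vec z) i s j t u"
proof -
  define p where "p = floor_vec z"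
  define K where "K = {y. \<forall>k. of_int (p $ k) \<le> lam $ k + y \<bullet> b k \<and> lam $ k + y \<bullet> b k \<le> of_int (p $ k) + 1}"
  have "K = (\<Inter>k. {y. of_int (p $ k) \<le> lam $ k + y \<bullet> b k} \<inter> {y. lam $ k + y \<bullet> b k \<le> of_int (p $ k) + 1})"
    by (auto simp: K_def)
  moreover have "closed \<dots>"
    by (intro closed_INT ballI closed_Int closed_Collect_le continuous_intros)
  ultimately have "closed K" by simp
  moreover have "bounded K"
  proof -
    obtain i j where ij: "det2 (b i) (b j) \<noteq> 0" using rank by blast
    define M where "M k = \<bar>of_int (p $ k)\<bar> + 1 + \<bar>lam $ k\<bar>" for k
    have M: "\<bar>y \<bullet> b k\<bar> \<le> M k" if "y \<in> K" for y k
    proof -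
      have "of_int (p $ k) \<le> lam $ k + y \<bullet> b k \<and> lam $ k + y \<bullet> b k \<le> of_int (p $ k) + 1"
        using that by (simp add: K_def)
      then show ?thesis unfolding M_def by linarith
    qed
    have "norm y \<le> (M i * norm (rot (b j)) + M j * norm (rot (b i))) / \<bar>det2 (b i) (b j)\<bar>"
      if "y \<in> K" for y
    proof -
      have "det2 (b i) (b j) *\<^sub>R y = (y \<bullet> b j) *\<^sub>R rot (b i) - (y \<bullet> b i) *\<^sub>R rot (b j)"
        by (simp add: vec2_eq_iff det2_def rot_def inner2 algebra_simps)
      then have "\<bar>det2 (b i) (b j)\<bar> * norm y = norm ((y \<bullet> b j) *\<^sub>R rot (b i) - (y \<bullet> b i) *\<^sub>R rot (b j))"
        by (metis norm_scaleR)
      also have "\<dots> \<le> \<bar>y \<bullet> b j\<bar> * norm (rot (b i)) + \<bar>y \<bullet> b i\<bar> * norm (rot (b j))"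
        by (rule order_trans[OF norm_triangle_ineq4]) simp
      also have "\<dots> \<le> M j * norm (rot (b i)) + M i * norm (rot (b j))"
        using M[OF that] by (intro add_mono mult_right_mono) auto
      finally show ?thesis using ij by (simp add: field_simps)
    qed
    then show ?thesis unfolding bounded_iff by blast
  qed
  ultimately have "compact K" by (simp add: compact_eq_bounded_closed)
  obtain y1 where y1: "\<And>k. z $ k = lam $ k + y1 \<bullet> b k" using z real_plane_iff by auto
  have "of_int (p $ k) \<le> z $ k \<and> z $ k \<le> of_int (p $ k) + 1" for k
    by (simp add: p_def floor_vec_def less_imp_le)
  then have "y1 \<in> K" by (simp add: K_def y1)
  then have "K \<noteq> {}" by blast
  then obtain y2 where y2: "y2 \<in> K" "\<And>y. y \<in> K \<Longrightarrow> u \<bullet> y \<le> u \<bullet> y2"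
    using continuous_attains_sup[OF \<open>compact K\<close> _ continuous_on_inner[OF continuous_on_const continuous_on_id], of u]
    by blast
  have "compact (K \<inter> {y. u \<bullet> y = u \<bullet> y2})"
    using \<open>compact K\<close> by (intro compact_Int_closed closed_Collect_eq continuous_intros)
  then obtain y0 where "y0 \<in> K \<inter> {y. u \<bullet> y = u \<bullet> y2}"
    and y0': "\<And>y. y \<in> K \<inter> {y. u \<bullet> y = u \<bullet> y2} \<Longrightarrow> rot u \<bullet> y \<le> rot u \<bullet> y0"
    using continuous_attains_sup[of "K \<inter> {y. u \<bullet> y = u \<bullet> y2}" "\<lambda>y. rot u \<bullet> y",
        OF _ _ continuous_on_inner[OF continuous_on_const continuous_on_id]] y2(1)
    by blast
  then have y0: "y0 \<in> K" "u \<bullet> y0 = u \<bullet> y2" by auto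
  define w where "w = (\<chi> k. lam $ k + y0 \<bullet> b k)"
  have w: "w \<in> real_plane L lam" unfolding real_plane_iff w_def by auto
  have cell: "of_int (p $ k) \<le> w $ k \<and> w $ k \<le> of_int (p $ k) + 1" for k
    using y0(1) by (simp add: K_def w_def)
  define s :: "'n \<Rightarrow> int" where "s k = (if w $ k = of_int (p $ k) then - 1 else 1)" for k
  have s: "\<bar>s k\<bar> = 1" for k by (simp add: s_def)
  have integer: "w $ k = of_int (p $ k) \<or> w $ k = of_int (p $ k) + 1" if int: "w $ k \<in> \<int>" for k
  proof -
    obtain m where m: "w $ k = of_int m" using int by (rule Ints_cases)
    then have "p $ k \<le> m" "m \<le> p $ k + 1" using cell[of k] by linarith+
    then have "m = p $ k \<or> m = p $ k + 1" by arith
    then show ?thesis using m by auto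
  qed
  have extremal: "u \<bullet> y < 0 \<or> u \<bullet> y = 0 \<and> rot u \<bullet> y \<le> 0"
    if out: "\<And>k. w $ k \<in> \<int> \<Longrightarrow> y \<bullet> (of_int (s k) *\<^sub>R b k) \<le> 0" for y
  proof -
    have "\<forall>\<^sub>F \<epsilon> in at_right 0. of_int (p $ k) \<le> w $ k + \<epsilon> * (y \<bullet> b k) \<and>
        w $ k + \<epsilon> * (y \<bullet> b k) \<le> of_int (p $ k) + 1" for k
    proof (intro eventually_conj eventually_stays_above eventually_stays_below)
      assume "w $ k = of_int (p $ k)"
      then show "y \<bullet> b k \<ge> 0" using out[of k] by (simp add: s_def)
    next
      assume *: "w $ k = of_int (p $ k) + 1"
      then have "w $ k \<in> \<int>" by simp
      with * show "y \<bullet> b k \<le> 0" using out[of k] by (simp add: s_def)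
    qed (use cell in auto)
    then have "\<forall>\<^sub>F \<epsilon> in at_right 0. \<forall>k. of_int (p $ k) \<le> w $ k + \<epsilon> * (y \<bullet> b k) \<and>
        w $ k + \<epsilon> * (y \<bullet> b k) \<le> of_int (p $ k) + 1"
      by (rule eventually_all_finite)
    moreover have "\<forall>\<^sub>F \<epsilon> in at_right 0. (0::real) < \<epsilon>" by (rule eventually_at_right_less)
    ultimately have "\<forall>\<^sub>F \<epsilon> in at_right (0::real). 0 < \<epsilon> \<and> y0 + \<epsilon> *\<^sub>R y \<in> K"
      by eventually_elim (auto simp: K_def w_def inner_add_left add.assoc)
    then have "\<exists>\<epsilon>. 0 < \<epsilon> \<and> y0 + \<epsilon> *\<^sub>R y \<in> K"
      by (rule eventually_happens'[rotated]) simp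
    then obtain \<epsilon> where \<epsilon>: "\<epsilon> > 0" "y0 + \<epsilon> *\<^sub>R y \<in> K" by blast
    have le: "\<epsilon> * (u \<bullet> y) \<le> 0" using y2(2)[OF \<epsilon>(2)] y0(2) by (simp add: inner_add_right)
    show ?thesis
    proof (cases "u \<bullet> y = 0")
      case True
      then have "y0 + \<epsilon> *\<^sub>R y \<in> K \<inter> {y. u \<bullet> y = u \<bullet> y2}"
        using \<epsilon>(2) y0(2) by (simp add: inner_add_right)
      from y0'[OF this] have "\<epsilon> * (rot u \<bullet> y) \<le> 0" by (simp add: inner_add_right)
      then show ?thesis using True \<epsilon>(1) by (simp add: mult_le_0_iff)
    next
      case False
      then show ?thesis using le \<epsilon>(1) by (auto simp: mult_le_0_iff)
    qed
  qed
  obtain i j where ij: "{i. w $ i \<in> \<int>} = {i, j}" "i \<noteq> j" "det2 (b i) (b j) \<noteq> 0"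
  proof (cases rule: integer_coordinates_cases[OF nr w])
    case (1 i)
    \<comment> \<open>If at most one grid line passes through \<open>w\<close>, then one can move along it in both directions,
       so that \<open>y0\<close> is not extremal.\<close>
    have perp: "rot (b i) \<bullet> b i = 0" by (simp add: inner2 rot_def)
    have "u \<bullet> y < 0 \<or> u \<bullet> y = 0 \<and> rot u \<bullet> y \<le> 0" if "y = rot (b i) \<or> y = - rot (b i)" for y
    proof (rule extremal)
      fix k assume "w $ k \<in> \<int>"
      then have "k = i" using 1 by blast
      then show "y \<bullet> (of_int (s k) *\<^sub>R b k) \<le> 0" using that perp by auto
    qed
    from this[of "rot (b i)"] this[of "- rot (b i)"]
    have "u \<bullet> rot (b i) = 0" "rot u \<bullet> rot (b i) = 0" by auto
    then have "(u \<bullet> u) *\<^sub>R rot (b i) = 0"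
      by (simp add: vec2_eq_iff inner2 rot_def algebra_simps) algebra
    then have False using u rot_nonzero[OF nonzero] by simp
    then show thesis ..
  qed (use that in blast)
  let ?v = "\<lambda>k. of_int (s k) *\<^sub>R b k"
  have det: "det2 (?v i) (?v j) \<noteq> 0" using ij(3) s[of i] s[of j] by (auto simp: det2_scale)
  define \<alpha> \<beta> where "\<alpha> = det2 u (?v j) / det2 (?v i) (?v j)" and "\<beta> = det2 (?v i) u / det2 (?v i) (?v j)"
  have u_eq: "u = \<alpha> *\<^sub>R ?v i + \<beta> *\<^sub>R ?v j"
    unfolding \<alpha>_def \<beta>_def by (rule cramer_coordinates[OF det])
  have pos: "x * \<alpha> + x' * \<beta> \<le> 0" if "x \<le> 0" "x' \<le> 0" for x x'
  proof -
    obtain y where y: "y \<bullet> ?v i = x" "y \<bullet> ?v j = x'" using prescribed_inner_products[OF det] .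
    have "y \<bullet> ?v k \<le> 0" if "w $ k \<in> \<int>" for k
    proof -
      have "k = i \<or> k = j" using ij(1) that by blast
      then show ?thesis using y \<open>x \<le> 0\<close> \<open>x' \<le> 0\<close> by metis
    qed
    then have "u \<bullet> y < 0 \<or> u \<bullet> y = 0 \<and> rot u \<bullet> y \<le> 0" by (rule extremal)
    then have "u \<bullet> y \<le> 0" by auto
    moreover have "y \<bullet> u = \<alpha> * (y \<bullet> ?v i) + \<beta> * (y \<bullet> ?v j)"
      by (subst u_eq) (simp add: inner_add_right)
    ultimately have "\<alpha> * (y \<bullet> ?v i) + \<beta> * (y \<bullet> ?v j) \<le> 0" by (simp add: inner_commute[of u])
    then show ?thesis by (simp only: y mult.commute)
  qed
  have "\<alpha> \<ge> 0" "\<beta> \<ge> 0" using pos[of "- 1" 0] pos[of 0 "- 1"] by auto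
  then have cone: "u \<in> cone2 (?v i) (?v j)" unfolding cone2_def using u_eq by blast
  have move: "p' \<in> floor_vec ` real_plane L lam"
    if "\<And>k. p' $ k = p $ k \<or> k \<in> {i, j} \<and> p' $ k = p $ k + s k" for p'
  proof (rule vertex_if_in_closed_cell[OF nr w])
    fix k
    show "of_int (p' $ k) \<le> w $ k \<and> w $ k \<le> of_int (p' $ k) + 1"
    proof (cases "p' $ k = p $ k")
      case True
      then show ?thesis using cell[of k] by simp
    next
      case False
      then have k: "k \<in> {i, j}" "p' $ k = p $ k + s k" using that[of k] by blast+
      then have "w $ k \<in> \<int>" using ij(1) by blast
      from integer[OF this] show ?thesis unfolding k(2) by (auto simp: s_def)
    qed
  qed
  have "p + axis i (s i) \<in> floor_vec ` real_plane L lam"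
    "p + axis j (s j) \<in> floor_vec ` real_plane L lam"
    "p + axis i (s i) + axis j (s j) \<in> floor_vec ` real_plane L lam"
    using ij(2) by (auto intro!: move simp: axis_def split: if_splits)
  then have "sector (floor_vec ` real_plane L lam) p i (s i) j (s j) u"
    using s ij(3) cone by (simp add: sector_def)
  then show ?thesis unfolding p_def by blast
qed

lemma stepped_initial:
  assumes "non_resonant L lam"
  shows "stepped (floor_vec ` real_plane L lam)"
  unfolding stepped_def
proof (intro conjI ballI impI allI)
  fix p l assume "p \<in> floor_vec ` real_plane L lam" "l \<in> L"
  then obtain z where z: "p = floor_vec z" "z \<in> real_plane L lam" by blast
  obtain y where y: "\<And>i. real_of_int (l $ i) = y \<bullet> b i"
    using lattice_functional[OF \<open>l \<in> L\<close>] by blast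
  have "p + l = floor_vec (z + (\<chi> i. y \<bullet> b i))"
    by (simp add: z floor_vec_def vec_eq_iff flip: y)
  then show "p + l \<in> floor_vec ` real_plane L lam" using real_plane_shift[OF z(2)] by blast
next
  fix p r assume "p \<in> floor_vec ` real_plane L lam" "r \<in> floor_vec ` real_plane L lam"
  then obtain z z' where z: "p = floor_vec z" "z \<in> real_plane L lam" "r = floor_vec z'" "z' \<in> real_plane L lam"
    by blast
  then obtain y where y: "\<And>i. z' $ i - z $ i = y \<bullet> b i" using real_plane_difference by blast
  have "((r - p) $ i > 0 \<longrightarrow> y \<bullet> b i > 0) \<and> ((r - p) $ i < 0 \<longrightarrow> y \<bullet> b i < 0)" for i
    using floor_mono[of "z $ i" "z' $ i"] floor_mono[of "z' $ i" "z $ i"]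
    by (auto simp: z floor_vec_def y[symmetric] not_le[symmetric])
  then show "aligned (r - p)" unfolding aligned_def by blast
next
  fix p r assume "p \<in> floor_vec ` real_plane L lam" "r \<in> floor_vec ` real_plane L lam" "p \<noteq> r"
  then show "approach (floor_vec ` real_plane L lam) p (r - p)" using approach_initial[OF assms] by blast
next
  fix p u assume "p \<in> floor_vec ` real_plane L lam" "(u :: real ^ 2) \<noteq> 0"
  then show "\<exists>i s j t. sector (floor_vec ` real_plane L lam) p i s j t u"
    using sector_initial[OF assms] by blast
qed

lemma stepped_surface: "surface_vertices L V \<Longrightarrow> stepped V"
  by (induction rule: surface_vertices.induct)
    (use stepped_initial stepped_elementary_transformation in blast)+

end

section \<open>Sectors at extremal vertices\<close>

context plane_lattice
begin

text \<open>If \<open>b k\<close> belonged to the cone of the square, then no vector \<open>y\<close> could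
  lead from the neighbour in direction \<open>k\<close> to the opposite corner of the square.\<close>

lemma neighbour_not_in_square_cone:
  assumes "stepped V" "\<bar>s\<bar> = 1" "i \<noteq> j" "k \<noteq> i" "k \<noteq> j"
    and "p + axis i s + axis j s \<in> V" "p + axis k s \<in> V"
  shows "b k \<notin> cone2 (b i) (b j)"
proof
  assume "b k \<in> cone2 (b i) (b j)"
  then obtain c d where cd: "c \<ge> 0" "d \<ge> 0" "b k = c *\<^sub>R b i + d *\<^sub>R b j"
    unfolding cone2_def by blast
  define x where "x = p + axis i s + axis j s - (p + axis k s)"
  have x: "x $ i = s" "x $ j = s" "x $ k = - s"
    using assms(3-5) by (simp_all add: x_def axis_def)
  have "aligned x" unfolding x_def by (rule stepped_aligned) fact+
  then obtain y where y: "\<And>i. (x $ i > 0 \<longrightarrow> y \<bullet> b i > 0) \<and> (x $ i < 0 \<longrightarrow> y \<bullet> b i < 0)"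
    unfolding aligned_def by blast
  have yk: "y \<bullet> b k = c * (y \<bullet> b i) + d * (y \<bullet> b j)" by (simp add: cd(3) inner_add_right)
  have "of_int s * (y \<bullet> b i) > 0 \<and> of_int s * (y \<bullet> b j) > 0 \<and> of_int s * (y \<bullet> b k) < 0"
    using abs_one[OF assms(2)]
  proof
    assume "s = 1"
    then show ?thesis using y[of i] y[of j] y[of k] unfolding x by simp
  next
    assume "s = - 1"
    then show ?thesis using y[of i] y[of j] y[of k] unfolding x by simp
  qed
  moreover have "of_int s * (y \<bullet> b k) = c * (of_int s * (y \<bullet> b i)) + d * (of_int s * (y \<bullet> b j))"
    unfolding yk by (simp add: algebra_simps)
  moreover have "c * (of_int s * (y \<bullet> b i)) \<ge> 0" "d * (of_int s * (y \<bullet> b j)) \<ge> 0"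
    using calculation cd(1,2) by simp_all
  ultimately show False by linarith
qed

text \<open>If two squares at \<open>p\<close> had overlapping cones but different rays on one side of \<open>u\<close>, then the
  ray closer to \<open>u\<close> would belong to a neighbour inside the cone of the other square.\<close>

lemma same_ray:
  assumes "stepped V" "\<bar>s\<bar> = 1" "i \<noteq> j" "k \<noteq> m"
    and "p + axis i s \<in> V" "p + axis i s + axis j s \<in> V"
    and "p + axis k s \<in> V" "p + axis k s + axis m s \<in> V"
    and "u \<in> cone2 (b i) (b j)" "u \<in> cone2 (b k) (b m)"
    and sides: "det2 (b i) u * det2 (b j) u < 0" "det2 (b k) u * det2 (b m) u < 0"
    and same_side: "det2 (b i) u * det2 (b k) u > 0"
  shows "i = k"
proof (rule ccontr)
  assume "i \<noteq> k"
  have "k \<noteq> j" "i \<noteq> m" using sides same_side by (auto simp: mult.commute)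
  have "b k \<notin> cone2 (b i) (b j)"
    using assms \<open>i \<noteq> k\<close> \<open>k \<noteq> j\<close> by (intro neighbour_not_in_square_cone[of V s i j k p]) auto
  moreover have "b i \<notin> cone2 (b k) (b m)"
    using assms \<open>i \<noteq> k\<close> \<open>i \<noteq> m\<close> by (intro neighbour_not_in_square_cone[of V s k m i p]) auto
  ultimately show False using nested_rays assms(9,10) same_side by blast
qed

text \<open>In each square the two rays lie on different sides of \<open>u\<close>, and rays on the same side agree.\<close>

lemma square_cone_unique:
  assumes "stepped V" "\<bar>s\<bar> = 1" "i \<noteq> j" "k \<noteq> m"
    and "p + axis i s \<in> V" "p + axis j s \<in> V" "p + axis i s + axis j s \<in> V"
    and "p + axis k s \<in> V" "p + axis m s \<in> V" "p + axis k s + axis m s \<in> V"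
    and u: "u \<in> cone2 (b i) (b j)" "u \<in> cone2 (b k) (b m)"
    and off: "\<And>i. u \<notin> half_line (b i)"
  shows "{k, m} = {i, j}"
proof -
  have swap: "p + axis j s + axis i s = p + axis i s + axis j s" for i j
    by (simp add: ac_simps)
  have u': "u \<in> cone2 (b j) (b i)" "u \<in> cone2 (b m) (b k)"
    using u by (simp_all add: cone2_commute)
  have sides: "det2 (b i) u * det2 (b j) u < 0" "det2 (b k) u * det2 (b m) u < 0"
    using oriented_cone(2) nonzero off u by blast+
  then have sides': "det2 (b j) u * det2 (b i) u < 0" "det2 (b m) u * det2 (b k) u < 0"
    by (simp_all add: mult.commute)
  have mem: "p + axis j s + axis i s \<in> V" "p + axis m s + axis k s \<in> V"
    using assms(7,10) swap by metis+
  consider "det2 (b i) u * det2 (b k) u > 0 \<and> det2 (b j) u * det2 (b m) u > 0"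
    | "det2 (b i) u * det2 (b m) u > 0 \<and> det2 (b j) u * det2 (b k) u > 0"
    using sides by (simp add: mult_less_0_iff zero_less_mult_iff) argo
  then show ?thesis
  proof cases
    case 1
    then have "i = k" "j = m"
      using same_ray[of V s i j k m p u] same_ray[of V s j i m k p u] assms u' sides sides' mem
      by auto
    then show ?thesis by simp
  next
    case 2
    then have "i = m" "j = k"
      using same_ray[of V s i j m k p u] same_ray[of V s j i k m p u] assms u' sides sides' mem
      by auto
    then show ?thesis by auto
  qed
qed

text \<open>At a vertex all of whose neighbours lie on the same level, the sectors are the cones
  spanned by the vectors \<open>b i\<close>, up to a common sign.\<close>

lemma square_cone_exists:
  assumes "stepped V" "\<bar>s\<bar> = 1" "p \<in> V" "u \<noteq> 0"
    and level: "\<And>i t. \<lbrakk>\<bar>t\<bar> = 1; p + axis i t \<in> V\<rbrakk> \<Longrightarrow> t = s"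
  shows "\<exists>i j. i \<noteq> j \<and> p + axis i s \<in> V \<and> p + axis j s \<in> V \<and> p + axis i s + axis j s \<in> V \<and>
    u \<in> cone2 (b i) (b j)"
proof -
  have "of_int s *\<^sub>R u \<noteq> 0" using assms(2,4) by auto
  then obtain i t j t' where sec: "sector V p i t j t' (of_int s *\<^sub>R u)"
    using stepped_sector[OF assms(1,3)] by blast
  then have mem: "p + axis i t \<in> V" "p + axis j t' \<in> V" "p + axis i t + axis j t' \<in> V"
    and abs: "\<bar>t\<bar> = 1" "\<bar>t'\<bar> = 1" and det: "det2 (b i) (b j) \<noteq> 0"
    and cone: "of_int s *\<^sub>R u \<in> cone2 (of_int t *\<^sub>R b i) (of_int t' *\<^sub>R b j)"
    unfolding sector_def by blast+
  have t: "t = s" "t' = s" using level[OF abs(1) mem(1)] level[OF abs(2) mem(2)] by auto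
  obtain c d where cd: "c \<ge> 0" "d \<ge> 0"
    "of_int s *\<^sub>R u = c *\<^sub>R (of_int s *\<^sub>R b i) + d *\<^sub>R (of_int s *\<^sub>R b j)"
    using cone unfolding t cone2_def by blast
  have "of_int s *\<^sub>R u = of_int s *\<^sub>R (c *\<^sub>R b i + d *\<^sub>R b j)"
    unfolding cd(3) by (simp add: algebra_simps)
  then have "u = c *\<^sub>R b i + d *\<^sub>R b j" using assms(2) by (subst (asm) scaleR_cancel_left) auto
  then have "u \<in> cone2 (b i) (b j)" using cd unfolding cone2_def by blast
  moreover have "i \<noteq> j" using det by (auto simp: det2_def)
  ultimately show ?thesis using mem unfolding t by blast
qed

end

section \<open>Cones of the secondary fan\<close>

text \<open>A component of the complement of the rays cannot cross the boundary of a cone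
  that is spanned by two of them.\<close>

lemma component_in_cone_iff:
  assumes K: "K \<in> components (UNIV - (\<Union>i. half_line (b i)))" and u: "u \<in> K"
    and nz: "b i \<noteq> 0" "b j \<noteq> 0"
  shows "closure K \<subseteq> cone2 (b i) (b j) \<longleftrightarrow> u \<in> cone2 (b i) (b j)"
proof
  show "closure K \<subseteq> cone2 (b i) (b j) \<Longrightarrow> u \<in> cone2 (b i) (b j)"
    using u closure_subset by blast
next
  assume uc: "u \<in> cone2 (b i) (b j)"
  have off: "x \<notin> half_line (b k)" if "x \<in> K" for x k
    using in_components_subset[OF K] that by blast
  have det: "det2 (b i) (b j) \<noteq> 0" using oriented_cone(1) nz uc off[OF u] by blast
  define \<alpha> \<beta> where "\<alpha> x = det2 x (b j) / det2 (b i) (b j)"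
    and "\<beta> x = det2 (b i) x / det2 (b i) (b j)" for x
  have cont: "continuous_on UNIV \<alpha>" "continuous_on UNIV \<beta>"
    unfolding \<alpha>_def \<beta>_def det2_def using det
    by (auto intro!: continuous_intros simp: det2_def)
  have cone: "cone2 (b i) (b j) = {x. 0 \<le> \<alpha> x} \<inter> {x. 0 \<le> \<beta> x}"
    unfolding cone2_independent[OF det] \<alpha>_def \<beta>_def by auto
  have closed: "closed (cone2 (b i) (b j))"
    unfolding cone using cont by (intro closed_Int closed_Collect_le continuous_intros)
  define P where "P = {x. 0 < \<alpha> x} \<inter> {x. 0 < \<beta> x}"
  have "open P" unfolding P_def using cont by (intro open_Int open_Collect_less continuous_intros)
  have inner: "x \<in> P" if "x \<in> K" "x \<in> cone2 (b i) (b j)" for x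
  proof -
    have x: "x = \<alpha> x *\<^sub>R b i + \<beta> x *\<^sub>R b j"
      unfolding \<alpha>_def \<beta>_def by (rule cramer_coordinates[OF det])
    have nonneg: "\<alpha> x \<ge> 0" "\<beta> x \<ge> 0" using that(2) cone by auto
    have "\<alpha> x \<noteq> 0"
    proof
      assume "\<alpha> x = 0"
      then have "x = \<beta> x *\<^sub>R b j" using x by simp
      then show False using off[OF that(1), of j] nonneg half_line_iff by blast
    qed
    moreover have "\<beta> x \<noteq> 0"
    proof
      assume "\<beta> x = 0"
      then have "x = \<alpha> x *\<^sub>R b i" using x by simp
      then show False using off[OF that(1), of i] nonneg half_line_iff by blast
    qed
    ultimately show ?thesis using nonneg by (simp add: P_def)
  qed
  have "K \<subseteq> cone2 (b i) (b j)"
  proof (rule ccontr)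
    assume "\<not> ?thesis"
    then have "- cone2 (b i) (b j) \<inter> K \<noteq> {}" by blast
    moreover have "P \<inter> K \<noteq> {}" using inner[OF u uc] u by blast
    moreover have "P \<inter> - cone2 (b i) (b j) \<inter> K = {}" unfolding P_def cone by auto
    moreover have "K \<subseteq> P \<union> - cone2 (b i) (b j)" using inner by blast
    ultimately show False
      using connectedD[OF in_components_connected[OF K] \<open>open P\<close>, of "- cone2 (b i) (b j)"] closed
      by (simp add: open_Compl)
  qed
  then show "closure K \<subseteq> cone2 (b i) (b j)" using closed closure_minimal by blast
qed

section \<open>Tiles\<close>

lemma rvec_nth: "rvec p $ i = real_of_int (p $ i)"
  by (simp add: rvec_def)

lemma rvec_add: "rvec (p + r) = rvec p + rvec r"
  by (simp add: vec_eq_iff rvec_nth)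

lemma rvec_inject: "rvec p = rvec r \<longleftrightarrow> p = r"
  by (simp add: vec_eq_iff rvec_nth)

lemma coord_sum_add: "coord_sum (p + r) = coord_sum p + coord_sum r"
  by (simp add: coord_sum_def sum.distrib)

lemma coord_sum_axis: "coord_sum (axis i s) = s"
  by (simp add: coord_sum_def axis_def)

lemma corners_commute: "corners p i j = corners p j i"
  by (auto simp: corners_def ac_simps)

lemma corners_translate: "corners (p + l) i j = (\<lambda>r. r + l) ` corners p i j"
  by (auto simp: corners_def ac_simps)

lemma unit_square_commute: "unit_square p i j = unit_square p j i"
  by (simp add: unit_square_def corners_commute)

lemma unit_square_translate: "(\<lambda>x. rvec l + x) ` unit_square p i j = unit_square (p + l) i j"
proof -
  have "rvec ` corners (p + l) i j = (\<lambda>x. rvec l + x) ` rvec ` corners p i j"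
    unfolding corners_translate image_image rvec_add by (simp only: add.commute)
  then show ?thesis unfolding unit_square_def by (simp only: convex_hull_translation)
qed

text \<open>In each coordinate a corner attains a bound of the square, and this prevents it from
  lying strictly between two different points. Hence the square determines its corners.\<close>

lemma extreme_points_unit_square:
  assumes "i \<noteq> j"
  shows "rvec c extreme_point_of unit_square p i j \<longleftrightarrow> c \<in> corners p i j"
proof
  assume "rvec c extreme_point_of unit_square p i j"
  then have "rvec c \<in> rvec ` corners p i j"
    unfolding unit_square_def by (rule extreme_point_of_convex_hull)
  then show "c \<in> corners p i j" by (auto simp: rvec_inject)
next
  assume c: "c \<in> corners p i j"
  let ?lo = "rvec p" and ?hi = "rvec (p + axis i 1 + axis j 1)"
  have corner: "rvec r $ k = ?lo $ k \<or> rvec r $ k = ?hi $ k" if "r \<in> corners p i j" for r k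
    using that assms by (auto simp: corners_def rvec_nth axis_def)
  have le: "?lo $ k \<le> ?hi $ k" for k by (simp add: rvec_nth axis_def)
  have "rvec ` corners p i j \<subseteq> cbox ?lo ?hi"
    using corner le unfolding mem_box_cart subset_iff image_iff by (metis order_refl)
  then have hull: "unit_square p i j \<subseteq> cbox ?lo ?hi"
    unfolding unit_square_def by (intro hull_minimal convex_box)
  show "rvec c extreme_point_of unit_square p i j"
    unfolding extreme_point_of_def
  proof (intro conjI ballI notI)
    show "rvec c \<in> unit_square p i j"
      using c unfolding unit_square_def by (intro hull_inc) auto
    fix x y assume xy: "x \<in> unit_square p i j" "y \<in> unit_square p i j" "rvec c \<in> open_segment x y"
    then obtain t where t: "0 < t" "t < 1" "x \<noteq> y" "rvec c = (1 - t) *\<^sub>R x + t *\<^sub>R y"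
      by (auto simp: in_segment)
    have "x $ k = y $ k" for k
    proof -
      have b: "?lo $ k \<le> x $ k" "x $ k \<le> ?hi $ k" "?lo $ k \<le> y $ k" "y $ k \<le> ?hi $ k"
        using xy hull by (auto simp: mem_box_cart subset_iff)
      have e: "rvec c $ k = (1 - t) * x $ k + t * y $ k" by (simp add: t(4))
      have "(1 - t) * (x $ k - m) + t * (y $ k - m) = rvec c $ k - m" for m
        unfolding e by (simp add: algebra_simps)
      then have "(1 - t) * (x $ k - rvec c $ k) + t * (y $ k - rvec c $ k) = 0" by simp
      \<comment> \<open>At a corner both terms have the same sign.\<close>
      moreover have "(1 - t) * (x $ k - rvec c $ k) \<ge> 0 \<and> t * (y $ k - rvec c $ k) \<ge> 0 \<or>
          (1 - t) * (x $ k - rvec c $ k) \<le> 0 \<and> t * (y $ k - rvec c $ k) \<le> 0"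
        using corner[OF c, of k] b t(1,2) by (auto intro!: mult_nonneg_nonneg mult_nonneg_nonpos)
      ultimately have "(1 - t) * (x $ k - rvec c $ k) = 0 \<and> t * (y $ k - rvec c $ k) = 0"
        by linarith
      then show ?thesis using t(1,2) by simp
    qed
    then show False using t(3) by (simp add: vec_eq_iff)
  qed
qed

lemma corners_coord_sum:
  assumes "c \<in> corners p i j"
  shows "coord_sum c = coord_sum p \<and> c = p \<or>
    coord_sum c = coord_sum p + 1 \<and> c \<in> {p + axis i 1, p + axis j 1} \<or>
    coord_sum c = coord_sum p + 2 \<and> c = p + axis i 1 + axis j 1"
  using assms by (auto simp: corners_def coord_sum_add coord_sum_axis)

text \<open>The coordinate sum tells the lowest corner from the two middle ones, and these name the
  two axes.\<close>

lemma corners_eqD: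
  assumes "corners p i j = corners r k m"
  shows "p = r \<and> {i, j} = {k, m}"
proof -
  have "p \<in> corners r k m" "r \<in> corners p i j" using assms by (auto simp: corners_def)
  then have "p = r" using corners_coord_sum[of p r k m] corners_coord_sum[of r p i j] by auto
  have sub: "{i, j} \<subseteq> {k, m}" if "corners p i j = corners p k m" for i j k m
  proof -
    have "p + axis x 1 \<in> {p + axis k 1, p + axis m 1}" if "x \<in> {i, j}" for x
    proof -
      have "p + axis x 1 \<in> corners p i j" using that by (auto simp: corners_def)
      then have "p + axis x 1 \<in> corners p k m" using \<open>corners p i j = corners p k m\<close> by simp
      from corners_coord_sum[OF this] show ?thesis by (simp add: coord_sum_add coord_sum_axis)
    qed
    then show ?thesis by (auto simp: axis_eq_axis)
  qed
  then show ?thesis using assms \<open>p = r\<close> by blast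
qed

lemma unit_square_eqD:
  assumes "i \<noteq> j" "k \<noteq> m" "unit_square p i j = unit_square r k m"
  shows "p = r \<and> {i, j} = {k, m}"
proof -
  have "corners p i j = corners r k m"
    using extreme_points_unit_square[OF assms(1)] extreme_points_unit_square[OF assms(2)] assms(3)
    by (metis subsetI subset_antisym)
  then show ?thesis by (rule corners_eqD)
qed

lemma square_orbit_unit_square:
  "square_orbit L (unit_square p i j) = {unit_square (p + l) i j | l. l \<in> L}"
  by (simp add: square_orbit_def unit_square_translate)

context plane_lattice
begin

lemma square_orbit_translate:
  assumes "l \<in> L"
  shows "square_orbit L (unit_square (p + l) i j) = square_orbit L (unit_square p i j)"
proof -
  have "{unit_square (p + l + l') i j | l'. l' \<in> L} = {unit_square (p + l') i j | l'. l' \<in> L}"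
  proof (intro equalityI subsetI)
    fix Q assume "Q \<in> {unit_square (p + l + l') i j | l'. l' \<in> L}"
    then show "Q \<in> {unit_square (p + l') i j | l'. l' \<in> L}"
      using add_mem[OF assms] by (auto simp: add.assoc)
  next
    fix Q assume "Q \<in> {unit_square (p + l') i j | l'. l' \<in> L}"
    then obtain l' where "l' \<in> L" "Q = unit_square (p + l + (l' - l)) i j" by auto
    then show "Q \<in> {unit_square (p + l + l') i j | l'. l' \<in> L}"
      using diff_mem assms by blast
  qed
  then show ?thesis by (simp only: square_orbit_unit_square)
qed

lemma tile_type_eq:
  assumes "i \<noteq> j"
  shows "tile_type (square_orbit L (unit_square p i j)) = {i, j}"
  unfolding tile_type_def
proof (rule the_equality)
  have "unit_square (p + 0) i j \<in> square_orbit L (unit_square p i j)"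
    unfolding square_orbit_unit_square using zero_mem by blast
  then show "\<exists>p' i' j'. i' \<noteq> j' \<and> unit_square p' i' j' \<in> square_orbit L (unit_square p i j) \<and> {i, j} = {i', j'}"
    using assms by blast
next
  fix I assume "\<exists>p' i' j'. i' \<noteq> j' \<and> unit_square p' i' j' \<in> square_orbit L (unit_square p i j) \<and> I = {i', j'}"
  then obtain p' i' j' l where "i' \<noteq> j'" "I = {i', j'}" "unit_square p' i' j' = unit_square (p + l) i j"
    unfolding square_orbit_unit_square by blast
  then show "I = {i, j}" using unit_square_eqD assms by blast
qed

end

locale perpendicular_lattice = plane_lattice L b for L :: "(int ^ 'n::finite) set" and b +
  assumes perpendicular: "l \<in> L \<Longrightarrow> coord_sum l = 0"
begin

lemma coord_sum_orbit:
  assumes "orbit L p = orbit L r"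
  shows "coord_sum p = coord_sum r"
proof -
  have "r \<in> orbit L p" using assms zero_mem orbit_iff[of r r] by simp
  then obtain l where "r = p + l" "l \<in> L" by (auto simp: orbit_def)
  then show ?thesis using perpendicular by (simp add: coord_sum_add)
qed

text \<open>A lattice translation preserves the coordinate sum, so all squares of the orbit single out
  translates of the same corner.\<close>

lemma vertex_class_eq:
  assumes "i \<noteq> j" and c: "c \<in> corners p i j"
    and unique: "\<And>c'. \<lbrakk>c' \<in> corners p i j; coord_sum c' = coord_sum c\<rbrakk> \<Longrightarrow> c' = c"
  shows "vertex_class L (coord_sum c) (square_orbit L (unit_square p i j)) = orbit L c"
  unfolding vertex_class_def
proof (rule the_equality)
  have "unit_square (p + 0) i j \<in> square_orbit L (unit_square p i j)"
    unfolding square_orbit_unit_square using zero_mem by blast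
  moreover have "rvec c extreme_point_of unit_square (p + 0) i j"
    using extreme_points_unit_square[OF assms(1)] assms(2) by simp
  ultimately show "\<exists>Q r. Q \<in> square_orbit L (unit_square p i j) \<and> rvec r extreme_point_of Q \<and>
      coord_sum r = coord_sum c \<and> orbit L c = orbit L r"
    by blast
next
  fix v assume "\<exists>Q r. Q \<in> square_orbit L (unit_square p i j) \<and> rvec r extreme_point_of Q \<and>
      coord_sum r = coord_sum c \<and> v = orbit L r"
  then obtain r l where l: "l \<in> L" "rvec r extreme_point_of unit_square (p + l) i j"
    "coord_sum r = coord_sum c" "v = orbit L r"
    unfolding square_orbit_unit_square by blast
  then have "r \<in> corners (p + l) i j" using extreme_points_unit_square assms(1) by blast
  then obtain c' where "c' \<in> corners p i j" "r = c' + l" unfolding corners_translate by blast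
  moreover then have "c' = c"
    using unique l perpendicular by (simp add: coord_sum_add)
  ultimately show "v = orbit L c" using l orbit_eq by simp
qed

end

section \<open>The matching\<close>

text \<open>A relation \<open>det2 (b i) (b j) = 0\<close> for all \<open>j\<close> would be a linear relation between the two rows of
  the basis matrix. The integer points of the dual plane span it, and the lattice is their image.\<close>

lemma plane_lattice_bvec:
  fixes L :: "(int ^ 'n::finite) set" and B :: "int ^ 'n ^ 2"
  assumes basis: "Z_basis L B" and nz: "\<forall>i. \<exists>l\<in>L. l $ i \<noteq> 0"
  shows "plane_lattice L (bvec B)"
proof
  have L: "L = range (\<lambda>c. c v* B)" and inj: "inj (\<lambda>c. c v* B)"
    using basis by (auto simp: Z_basis_def)
  have nth: "(c v* B) $ i = c $ 1 * B $ 1 $ i + c $ 2 * B $ 2 $ i" for c i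
    by (simp add: vector_matrix_mult_def sum_2 mult.commute)
  have bvec1: "bvec B i $ 1 = of_int (B $ 1 $ i)" "bvec B i $ 2 = of_int (B $ 2 $ i)" for i
    by (simp_all add: bvec_def rvec_nth column_def)
  have add: "c v* B + c' v* B = (c + c') v* B" for c c' by (simp add: vec_eq_iff nth algebra_simps)
  have minus: "- (c v* B) = (- c) v* B" for c by (simp add: vec_eq_iff nth algebra_simps)
  have zero: "0 = 0 v* B" by (simp add: vec_eq_iff nth)
  show "0 \<in> L" unfolding L using zero by blast
  show "l + l' \<in> L" if "l \<in> L" "l' \<in> L" for l l' using that unfolding L by (auto simp: add)
  show "- l \<in> L" if "l \<in> L" for l using that unfolding L by (auto simp: minus)
  show b_nz: "bvec B i \<noteq> 0" for i
  proof
    assume "bvec B i = 0"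
    then have "B $ 1 $ i = 0" "B $ 2 $ i = 0" using bvec1[of i] by simp_all
    then have "l $ i = 0" if "l \<in> L" for l using that unfolding L by (auto simp: nth)
    then show False using nz by blast
  qed
  show "\<exists>i j. det2 (bvec B i) (bvec B j) \<noteq> 0"
  proof (rule ccontr)
    assume contra: "\<not> ?thesis"
    fix i :: 'n
    let ?c = "vector [- B $ 2 $ i, B $ 1 $ i] :: int ^ 2"
    have "(?c v* B) $ j = 0" for j
    proof -
      have "det2 (bvec B i) (bvec B j) = 0" using contra by blast
      then have "real_of_int (B $ 1 $ i * B $ 2 $ j - B $ 2 $ i * B $ 1 $ j) = 0"
        by (simp add: det2_def bvec1)
      then show ?thesis by (simp only: of_int_eq_0_iff nth vector_2)
    qed
    then have "?c v* B = 0 v* B" using zero by (simp add: vec_eq_iff)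
    then have "?c = 0" using inj by (simp add: inj_def)
    then have "B $ 2 $ i = 0" "B $ 1 $ i = 0" by (simp_all add: vec_eq_iff forall_2)
    then show False using b_nz[of i] by (simp add: vec2_eq_iff bvec1)
  qed
  let ?f = "\<lambda>y. \<chi> i. y \<bullet> bvec B i"
  have lin: "linear ?f"
    by (rule linearI) (simp_all add: vec_eq_iff inner_add_left)
  have f: "rvec (c v* B) = ?f (rvec c)" for c
    by (simp add: vec_eq_iff rvec_nth nth inner2 bvec1)
  have "rvec ` L = ?f ` range rvec" by (simp only: L image_image f)
  moreover have "span (range rvec :: (real ^ 2) set) = UNIV"
  proof -
    have "(axis k 1 :: real ^ 2) = rvec (axis k 1)" for k
      by (simp add: vec_eq_iff rvec_nth axis_def)
    then have "(Basis :: (real ^ 2) set) \<subseteq> range rvec" by (auto simp: Basis_vec_def)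
    then show ?thesis by (metis span_Basis span_mono top.extremum_uniqueI)
  qed
  ultimately show "span (rvec ` L) = range ?f"
    using linear_span_image[OF lin, of "range rvec"] by simp
qed

context perpendicular_lattice
begin

text \<open>The white and the black end of a matched tile are treated alike: the square has the vertex
  \<open>p\<close> as its lowest corner if \<open>s = 1\<close> and as its highest corner if \<open>s = - 1\<close>.\<close>

definition lowest :: "int \<Rightarrow> int ^ 'n \<Rightarrow> 'n \<Rightarrow> 'n \<Rightarrow> int ^ 'n" where
  "lowest s p i j = (if s = 1 then p else p + axis i s + axis j s)"

abbreviation tile :: "int \<Rightarrow> int ^ 'n \<Rightarrow> 'n \<Rightarrow> 'n \<Rightarrow> (real ^ 'n) set set" where
  "tile s p i j \<equiv> square_orbit L (unit_square (lowest s p i j) i j)"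

lemma corners_lowest:
  assumes "\<bar>s\<bar> = 1"
  shows "corners (lowest s p i j) i j = {p, p + axis i s, p + axis j s, p + axis i s + axis j s}"
proof (cases "s = 1")
  case True
  then show ?thesis by (simp add: lowest_def corners_def)
next
  case False
  then have s: "s = - 1" using assms by auto
  let ?r = "p + axis i (- 1) + axis j (- 1)"
  have "?r + axis i 1 = p + axis j (- 1)" "?r + axis j 1 = p + axis i (- 1)"
    "?r + axis i 1 + axis j 1 = p"
    by (simp_all add: vec_eq_iff axis_def)
  then show ?thesis by (auto simp: s lowest_def corners_def)
qed

lemma lowest_translate: "lowest s (p + l) i j = lowest s p i j + l"
  by (simp add: lowest_def ac_simps)

lemma lowest_commute: "lowest s p i j = lowest s p j i"
  by (simp add: lowest_def ac_simps)

lemma tile_type_tile: "i \<noteq> j \<Longrightarrow> tile_type (tile s p i j) = {i, j}"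
  by (rule tile_type_eq)

lemma vertex_class_tile:
  assumes "\<bar>s\<bar> = 1" "i \<noteq> j"
  shows "vertex_class L (coord_sum p) (tile s p i j) = orbit L p"
  using assms abs_one[OF assms(1)]
  by (intro vertex_class_eq) (auto simp: corners_lowest coord_sum_add coord_sum_axis)

lemma tile_translate: "l \<in> L \<Longrightarrow> tile s (p + l) i j = tile s p i j"
  by (simp only: lowest_translate square_orbit_translate)

lemma tile_commute: "tile s p i j = tile s p j i"
  by (simp only: lowest_commute[of s p i] unit_square_commute[of _ i])

text \<open>A square meets three consecutive levels. If all vertices lie on three levels, then one of its
  corners lies on the extremal one.\<close>

lemma tile_at_extremal_level:
  assumes "e \<in> tiles L V" "\<bar>s\<bar> = 1"
    and level: "\<forall>r\<in>V. 0 \<le> s * (coord_sum r - m) \<and> s * (coord_sum r - m) \<le> 2"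
  obtains p i j where "i \<noteq> j" "e = tile s p i j" "corners (lowest s p i j) i j \<subseteq> V" "coord_sum p = m"
proof -
  obtain r i j where e: "i \<noteq> j" "corners r i j \<subseteq> V" "e = square_orbit L (unit_square r i j)"
    using assms(1) unfolding tiles_def squares_def by blast
  define p where "p = (if s = 1 then r else r + axis i 1 + axis j 1)"
  have mem: "r \<in> V" "r + axis i 1 + axis j 1 \<in> V" using e(2) by (auto simp: corners_def)
  have "lowest s p i j = r \<and> coord_sum p = m"
    using abs_one[OF assms(2)]
  proof
    assume "s = 1"
    then show ?thesis
      using bspec[OF level mem(1)] bspec[OF level mem(2)]
      by (simp add: lowest_def p_def coord_sum_add coord_sum_axis)
  next
    assume "s = - 1"
    moreover have "r + axis i 1 + axis j 1 + axis i (- 1) + axis j (- 1) = r"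
      by (simp add: vec_eq_iff axis_def)
    ultimately show ?thesis
      using bspec[OF level mem(1)] bspec[OF level mem(2)]
      by (simp add: lowest_def p_def coord_sum_add coord_sum_axis)
  qed
  then show ?thesis using that[of i j p] e by simp
qed

text \<open>At a vertex on an extremal level all edges lead in the same vertical direction \<open>s\<close>. Up to this sign
  the sectors at the vertex are the cones spanned by \<open>b i\<close> and \<open>b j\<close>, and exactly one of these cones
  contains \<open>u\<close>.\<close>

lemma unique_matched_tile:
  assumes V: "stepped V" and s: "\<bar>s\<bar> = 1" and p: "p \<in> V"
    and level: "\<forall>r\<in>V. 0 \<le> s * (coord_sum r - coord_sum p) \<and> s * (coord_sum r - coord_sum p) \<le> 2"
    and u: "\<And>i. u \<notin> half_line (b i)"
    and P: "\<forall>i j. i \<noteq> j \<longrightarrow> ({i, j} \<in> P \<longleftrightarrow> u \<in> cone2 (b i) (b j))"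
  shows "\<exists>!e. (e \<in> tiles L V \<and> tile_type e \<in> P) \<and> vertex_class L (coord_sum p) e = orbit L p"
proof -
  have "0 \<in> half_line (b i)" for i unfolding half_line_iff by (intro exI[of _ 0]) simp
  then have "u \<noteq> 0" using u by blast
  have outward: "t = s" if "\<bar>t\<bar> = 1" "p + axis i t \<in> V" for i t
  proof -
    have "s * t \<ge> 0" using bspec[OF level that(2)] by (simp add: coord_sum_add coord_sum_axis)
    then show ?thesis using abs_one[OF that(1)] abs_one[OF s] by auto
  qed
  have "\<exists>i j. i \<noteq> j \<and> p + axis i s \<in> V \<and> p + axis j s \<in> V \<and> p + axis i s + axis j s \<in> V \<and>
    u \<in> cone2 (b i) (b j)"
    by (rule square_cone_exists) fact+
  then obtain i j where ij: "i \<noteq> j" "p + axis i s \<in> V" "p + axis j s \<in> V"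
    "p + axis i s + axis j s \<in> V" "u \<in> cone2 (b i) (b j)"
    by blast
  show ?thesis
  proof (rule ex1I[of _ "tile s p i j"])
    have "corners (lowest s p i j) i j \<subseteq> V" using ij p by (simp add: corners_lowest[OF s])
    then have "tile s p i j \<in> tiles L V" unfolding tiles_def squares_def using ij(1) by blast
    then show "(tile s p i j \<in> tiles L V \<and> tile_type (tile s p i j) \<in> P) \<and>
        vertex_class L (coord_sum p) (tile s p i j) = orbit L p"
      using tile_type_tile[OF ij(1)] vertex_class_tile[OF s ij(1)] ij(1,5) P by simp
  next
    fix e assume e: "(e \<in> tiles L V \<and> tile_type e \<in> P) \<and> vertex_class L (coord_sum p) e = orbit L p"
    obtain r k m where km: "k \<noteq> m" "e = tile s r k m" "corners (lowest s r k m) k m \<subseteq> V"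
      "coord_sum r = coord_sum p"
      using tile_at_extremal_level[OF conjunct1[OF conjunct1[OF e]] s level] .
    have "orbit L r = orbit L p" using e vertex_class_tile[OF s km(1), of r] km by simp
    then have "p \<in> orbit L r" using zero_mem by (simp add: orbit_iff)
    then obtain l where l: "l \<in> L" "p = r + l" by (auto simp: orbit_def)
    have "e = tile s p k m" unfolding km(2) l(2) by (rule tile_translate[OF l(1), symmetric])
    have "p + axis k s \<in> V" "p + axis m s \<in> V" "p + axis k s + axis m s \<in> V"
    proof -
      have "corners (lowest s p k m) k m \<subseteq> V"
        unfolding l(2) lowest_translate corners_translate
        using km(3) stepped_translate[OF V _ l(1)] by blast
      then show "p + axis k s \<in> V" "p + axis m s \<in> V" "p + axis k s + axis m s \<in> V"
        by (simp_all add: corners_lowest[OF s])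
    qed
    moreover have "u \<in> cone2 (b k) (b m)"
      using e P km(1,2) tile_type_tile[OF km(1)] by simp
    ultimately have "{k, m} = {i, j}" using square_cone_unique[OF V s ij(1) km(1)] ij u by blast
    then consider "k = i" "m = j" | "k = j" "m = i" by (auto simp: doubleton_eq_iff)
    then show "e = tile s p i j" using \<open>e = tile s p k m\<close> tile_commute by cases auto
  qed
qed

end

theorem theorem7p2:
  fixes L :: "(int ^ 'n::finite) set" and B :: "int ^ 'n ^ 2"
    and V :: "(int ^ 'n) set" and a :: int and C :: "(real ^ 2) set"
  assumes rank_two: "Z_basis L B"
    and not_in_hyperplane: "\<forall>i. \<exists>l\<in>L. l $ i \<noteq> 0"
    and perpendicular: "\<forall>l\<in>L. coord_sum l = 0"
    and perfect: "perfect_surface L V a"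
    and cone: "C \<in> two_dim_cones B"
  shows "perfect_matching (bipartite_graph L V a)
           {e \<in> tiles L V. tile_type e \<in> cone_pairs B C}"
proof -
  interpret plane_lattice L "bvec B" using rank_two not_in_hyperplane by (rule plane_lattice_bvec)
  interpret perpendicular_lattice L "bvec B" using perpendicular by unfold_locales auto
  have V: "stepped V" using perfect stepped_surface by (simp add: perfect_surface_def)
  have "coord_sum ` V = {a - 1, a, a + 1}" using perfect by (simp add: perfect_surface_def)
  then have level: "coord_sum r \<in> {a - 1, a, a + 1}" if "r \<in> V" for r using that by blast
  obtain K where K: "K \<in> components (UNIV - (\<Union>i. half_line (bvec B i)))" "C = closure K"
    using cone unfolding two_dim_cones_def by blast
  obtain u where "u \<in> K" using in_components_nonempty[OF K(1)] by blast
  then have u: "u \<notin> half_line (bvec B i)" for i using in_components_subset[OF K(1)] by blast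
  let ?P = "cone_pairs B C"
  have P: "\<forall>i j. i \<noteq> j \<longrightarrow> ({i, j} \<in> ?P \<longleftrightarrow> u \<in> cone2 (bvec B i) (bvec B j))"
  proof (intro allI impI)
    fix i j :: 'n assume "i \<noteq> j"
    then have "{i, j} \<in> ?P \<longleftrightarrow> C \<subseteq> cone2 (bvec B i) (bvec B j)"
      using cone2_commute[of "bvec B i" "bvec B j"]
      unfolding cone_pairs_def cone2_def[symmetric] by (auto simp: doubleton_eq_iff)
    then show "{i, j} \<in> ?P \<longleftrightarrow> u \<in> cone2 (bvec B i) (bvec B j)"
      using component_in_cone_iff[OF K(1) \<open>u \<in> K\<close> nonzero nonzero] K(2) by simp
  qed
  have low: "\<forall>r\<in>V. 0 \<le> 1 * (coord_sum r - (a - 1)) \<and> 1 * (coord_sum r - (a - 1)) \<le> 2"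
    and high: "\<forall>r\<in>V. 0 \<le> - 1 * (coord_sum r - (a + 1)) \<and> - 1 * (coord_sum r - (a + 1)) \<le> 2"
    using level by fastforce+
  let ?white = "vertex_class L (a - 1)" and ?black = "vertex_class L (a + 1)"
  \<comment> \<open>The two ends of a tile lie on different levels, so an end in the orbit of \<open>p\<close> is the end
     on the level of \<open>p\<close>.\<close>
  have white: "\<exists>r. ?white e = orbit L r \<and> coord_sum r = a - 1"
    and black: "\<exists>r. ?black e = orbit L r \<and> coord_sum r = a + 1" if e: "e \<in> tiles L V" for e
  proof -
    obtain p i j where "i \<noteq> j" "e = tile 1 p i j" "coord_sum p = a - 1"
      by (rule tile_at_extremal_level[OF e _ low]) simp
    then show "\<exists>r. ?white e = orbit L r \<and> coord_sum r = a - 1"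
      using vertex_class_tile[of 1 i j p] by auto
    obtain p i j where "i \<noteq> j" "e = tile (- 1) p i j" "coord_sum p = a + 1"
      by (rule tile_at_extremal_level[OF e _ high]) simp
    then show "\<exists>r. ?black e = orbit L r \<and> coord_sum r = a + 1"
      using vertex_class_tile[of "- 1" i j p] by auto
  qed
  have "\<exists>!e. e \<in> {e \<in> tiles L V. tile_type e \<in> ?P} \<and> v \<in> {?black e, ?white e}"
    if v: "v \<in> orbit L ` {p \<in> V. coord_sum p = a + 1} \<union> orbit L ` {p \<in> V. coord_sum p = a - 1}" for v
  proof -
    consider p where "p \<in> V" "coord_sum p = a + 1" "v = orbit L p"
      | p where "p \<in> V" "coord_sum p = a - 1" "v = orbit L p"
      using v by blast
    then show ?thesis
    proof cases
      case (1 p)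
      have "\<exists>!e. (e \<in> tiles L V \<and> tile_type e \<in> ?P) \<and> ?black e = orbit L p"
        using unique_matched_tile[OF V _ 1(1) _ u P, of "- 1"] high unfolding 1(2) by simp
      moreover have "v \<in> {?black e, ?white e} \<longleftrightarrow> ?black e = orbit L p" if e: "e \<in> tiles L V" for e
      proof -
        obtain r where "?white e = orbit L r" "coord_sum r = a - 1" using white[OF e] by blast
        then have "v \<noteq> ?white e" using coord_sum_orbit[of p r] 1 by auto
        then show ?thesis using 1(3) by auto
      qed
      ultimately show ?thesis by (simp cong: conj_cong)
    next
      case (2 p)
      have "\<exists>!e. (e \<in> tiles L V \<and> tile_type e \<in> ?P) \<and> ?white e = orbit L p"
        using unique_matched_tile[OF V _ 2(1) _ u P, of 1] low unfolding 2(2) by simp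
      moreover have "v \<in> {?black e, ?white e} \<longleftrightarrow> ?white e = orbit L p" if e: "e \<in> tiles L V" for e
      proof -
        obtain r where "?black e = orbit L r" "coord_sum r = a + 1" using black[OF e] by blast
        then have "v \<noteq> ?black e" using coord_sum_orbit[of p r] 2 by auto
        then show ?thesis using 2(3) by auto
      qed
      ultimately show ?thesis by (simp cong: conj_cong)
    qed
  qed
  then show ?thesis unfolding perfect_matching_def bipartite_graph_def by auto
qed

end
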